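(* Let $\mathcal G$ be a compactly generated and topologically transitive pseudogroup acting on a Polish space $X$. Then $\mathcal G$ is either sensitive to initial conditions or almost equicontinuous. Moreover, if $\mathcal G$ is minimal (every $\mathcal G$-orbit is dense in $X$), then $\mathcal G$ is either sensitive to initial conditions or equicontinuous.
   Context: Metrics may take the value $\infty$; a metric is compatible if its open balls generate the topology. $\mathrm{Ph}(X)$ is the set of partial homeomorphisms of $X$, i.e. homeomorphisms $f\colon\mathrm{dom} f\to\mathrm{im} f$ between open subsets of $X$. The composition $gf$ has domain $f^{-1}(\mathrm{dom}\,g)$, and $f(A)$ means $f(A\cap\mathrm{dom} f)$. A pseudo$*$group on $X$ is a subset of $\mathrm{Ph}(X)$ containing $\mathrm{id}_X$ and closed under inversion, composition and restriction to open subsets of domains. A pseudogroup $\mathcal G\curvearrowright X$ is a pseudo$*$group such that if $f\in\mathrm{Ph}(X)$ and every $x\in\mathrm{dom} f$ has an open neighborhood $U_x$ with $f|_{U_x}\in\mathcal G$, then $f\in\mathcal G$. $S\subset\mathcal G$ generates $\mathcal G$ if $\mathcal G$ is the smallest pseudogroup containing $S$; $S^*$ denotes the smallest pseudo$*$group containing $S$. The orbit of $x$ is $\mathcal Gx=\{gx\mid g\in\mathcal G,\ x\in\mathrm{dom}\,g\}$. For open $U\subset X$, $\mathcal G|_U=\{f\in\mathcal G\mid\mathrm{dom} f,\mathrm{im} f\subset U\}$, a pseudogroup on $U$. $\mathcal G$ is compactly generated if there is a triple $(U,F,\widetilde F)$ (a system of compact generation) where $U\subset X$ is a relatively compact open set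 meeting every $\mathcal G$-orbit; $F\subset\mathcal G|_U$ and $\widetilde F\subset\mathcal G$ are finite and symmetric (closed under inversion); $F$ generates $\mathcal G|_U$; and there is a bijection $F\to\widetilde F$, $f\mapsto\tilde f$, such that $\tilde f$ extends $f$ and $\overline{\mathrm{dom} f}\subset\mathrm{dom}\,\tilde f$ for every $f\in F$. $\mathcal G$ is topologically transitive if for all non-empty open $U,V\subset X$ there is $g\in\mathcal G$ with $g(U)\cap V\ne\emptyset$. $\mathcal G$ is sensitive to initial conditions if for every compatible metric $d$ on $X$ and every pseudo$*$group $\mathcal S\subset\mathcal G$ generating $\mathcal G$ there is $c>0$ such that for every $x\in X$ and $r>0$ there are $s\in\mathcal S$ and $y$ with $x,y\in\mathrm{dom}\,s$, $d(x,y)<r$ and $d(sx,sy)\ge c$. For a generating set $S$ and compatible metric $d$, a point $x$ is $(S,d)$-equicontinuous if for every $\epsilon>0$ there is $\delta(\epsilon)>0$ such that $d(x,y)<\delta(\epsilon)$ implies $d(s(x),s(y))<\epsilon$ for every $s\in S^*$ and $y\in X$ with $x,y\in\mathrm{dom}\,s$. $\mathcal G$ is almost equicontinuous if there are a generating set $S$ and a compatible metric $d$ such that the $(S,d)$-equicontinuous points are dense in $X$. $\mathcal G$ is equicontinuous if there are a generating pseudo$*$group $\mathcal S$, a compatible metric $d$ and an assignment $\epsilon\mapsto\delta(\epsilon)>0$ such that $d(x,y)<\delta(\epsilon)$ implies $d(sx,sy)<\epsilon$ for every $\epsilon>0$, $s\in\mathcal S$ and $x,y\in\mathrm{dom}\,s$.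 *)

theory Defs
  imports "HOL-Analysis.Analysis"
begin

text \<open>
  A partial transformation of a space is a partial map \<open>f :: 'a \<rightharpoonup> 'a\<close>, with domain \<open>dom f\<close> and
  image \<open>ran f\<close>. With this encoding equality of partial maps is equality of domains and values,
  \<open>g \<circ>\<^sub>m f\<close> is the composition with domain \<open>f\<inverse>(dom g)\<close>, \<open>f |` V\<close> is the restriction to \<open>dom f \<inter> V\<close>,
  and \<open>f \<subseteq>\<^sub>m g\<close> says that \<open>g\<close> extends \<open>f\<close>. The empty map is a partial homeomorphism.
\<close>

definition partial_homeos :: "'a topology \<Rightarrow> ('a \<rightharpoonup> 'a) set" where
  "partial_homeos X =
    {f. openin X (dom f) \<and> openin X (ran f) \<and>
        homeomorphic_map (subtopology X (dom f)) (subtopology X (ran f)) (\<lambda>x. the (f x))}"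

text \<open>Only meaningful for \<open>f\<close> injective on its domain.\<close>

definition pinv :: "('a \<rightharpoonup> 'a) \<Rightarrow> ('a \<rightharpoonup> 'a)" where
  "pinv f = (\<lambda>y. if y \<in> ran f then Some (THE x. f x = Some y) else None)"

text \<open>The image \<open>f(A) = f(A \<inter> dom f)\<close>.\<close>

definition pimage :: "('a \<rightharpoonup> 'a) \<Rightarrow> 'a set \<Rightarrow> 'a set" where
  "pimage f A = {y. \<exists>x\<in>A. f x = Some y}"

definition pseudo_star_group :: "'a topology \<Rightarrow> ('a \<rightharpoonup> 'a) set \<Rightarrow> bool" where
  "pseudo_star_group X S \<longleftrightarrow>
    S \<subseteq> partial_homeos X \<and>
    Some |` topspace X \<in> S \<and>
    (\<forall>f\<in>S. pinv f \<in> S) \<and>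
    (\<forall>f\<in>S. \<forall>g\<in>S. g \<circ>\<^sub>m f \<in> S) \<and>
    (\<forall>f\<in>S. \<forall>V. openin X V \<and> V \<subseteq> dom f \<longrightarrow> f |` V \<in> S)"

definition pseudogroup :: "'a topology \<Rightarrow> ('a \<rightharpoonup> 'a) set \<Rightarrow> bool" where
  "pseudogroup X G \<longleftrightarrow>
    pseudo_star_group X G \<and>
    (\<forall>f\<in>partial_homeos X.
      (\<forall>x\<in>dom f. \<exists>U. openin X U \<and> x \<in> U \<and> U \<subseteq> dom f \<and> f |` U \<in> G) \<longrightarrow> f \<in> G)"

definition generates :: "'a topology \<Rightarrow> ('a \<rightharpoonup> 'a) set \<Rightarrow> ('a \<rightharpoonup> 'a) set \<Rightarrow> bool" where
  "generates X S G \<longleftrightarrow>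
    pseudogroup X G \<and> S \<subseteq> G \<and> (\<forall>H. pseudogroup X H \<and> S \<subseteq> H \<longrightarrow> G \<subseteq> H)"

text \<open>
  The smallest pseudo*group containing \<open>S\<close>; only used for \<open>S \<subseteq> partial_homeos X\<close>, where the
  intersection is over a non-empty family and is itself a pseudo*group.
\<close>

definition star_closure :: "'a topology \<Rightarrow> ('a \<rightharpoonup> 'a) set \<Rightarrow> ('a \<rightharpoonup> 'a) set" where
  "star_closure X S = \<Inter>{T. pseudo_star_group X T \<and> S \<subseteq> T}"

definition orbit_of :: "('a \<rightharpoonup> 'a) set \<Rightarrow> 'a \<Rightarrow> 'a set" where
  "orbit_of G x = {y. \<exists>g\<in>G. g x = Some y}"

definition pg_restrict :: "('a \<rightharpoonup> 'a) set \<Rightarrow> 'a set \<Rightarrow> ('a \<rightharpoonup> 'a) set" where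
  "pg_restrict G U = {f\<in>G. dom f \<subseteq> U \<and> ran f \<subseteq> U}"

definition symmetric_maps :: "('a \<rightharpoonup> 'a) set \<Rightarrow> bool" where
  "symmetric_maps F \<longleftrightarrow> (\<forall>f\<in>F. pinv f \<in> F)"

definition compact_generation_system ::
  "'a topology \<Rightarrow> ('a \<rightharpoonup> 'a) set \<Rightarrow> 'a set \<Rightarrow> ('a \<rightharpoonup> 'a) set \<Rightarrow> ('a \<rightharpoonup> 'a) set \<Rightarrow> bool" where
  "compact_generation_system X G U F F' \<longleftrightarrow>
    openin X U \<and> compactin X (X closure_of U) \<and>
    (\<forall>x\<in>topspace X. orbit_of G x \<inter> U \<noteq> {}) \<and>
    F \<subseteq> pg_restrict G U \<and> finite F \<and> symmetric_maps F \<and>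
    F' \<subseteq> G \<and> finite F' \<and> symmetric_maps F' \<and>
    generates (subtopology X U) F (pg_restrict G U) \<and>
    (\<exists>ext. bij_betw ext F F' \<and>
      (\<forall>f\<in>F. f \<subseteq>\<^sub>m ext f \<and> X closure_of (dom f) \<subseteq> dom (ext f)))"

definition compactly_generated :: "'a topology \<Rightarrow> ('a \<rightharpoonup> 'a) set \<Rightarrow> bool" where
  "compactly_generated X G \<longleftrightarrow> (\<exists>U F F'. compact_generation_system X G U F F')"

definition topologically_transitive :: "'a topology \<Rightarrow> ('a \<rightharpoonup> 'a) set \<Rightarrow> bool" where
  "topologically_transitive X G \<longleftrightarrow>
    (\<forall>U V. openin X U \<and> U \<noteq> {} \<and> openin X V \<and> V \<noteq> {} \<longrightarrow> (\<exists>g\<in>G. pimage g U \<inter> V \<noteq> {}))"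

definition minimal_action :: "'a topology \<Rightarrow> ('a \<rightharpoonup> 'a) set \<Rightarrow> bool" where
  "minimal_action X G \<longleftrightarrow> (\<forall>x\<in>topspace X. X closure_of (orbit_of G x) = topspace X)"

text \<open>Metrics may take the value \<open>\<infinity>\<close>, so \<open>Metric_space\<close> does not apply.\<close>

definition ext_metric_on :: "'a set \<Rightarrow> ('a \<Rightarrow> 'a \<Rightarrow> ennreal) \<Rightarrow> bool" where
  "ext_metric_on M d \<longleftrightarrow>
    (\<forall>x\<in>M. \<forall>y\<in>M. d x y = 0 \<longleftrightarrow> x = y) \<and>
    (\<forall>x\<in>M. \<forall>y\<in>M. d x y = d y x) \<and>
    (\<forall>x\<in>M. \<forall>y\<in>M. \<forall>z\<in>M. d x z \<le> d x y + d y z)"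

definition compatible_metric :: "'a topology \<Rightarrow> ('a \<Rightarrow> 'a \<Rightarrow> ennreal) \<Rightarrow> bool" where
  "compatible_metric X d \<longleftrightarrow>
    ext_metric_on (topspace X) d \<and>
    X = topology_generated_by
          {{y \<in> topspace X. d x y < ennreal r} | x r. x \<in> topspace X \<and> r > 0}"

definition sensitive :: "'a topology \<Rightarrow> ('a \<rightharpoonup> 'a) set \<Rightarrow> bool" where
  "sensitive X G \<longleftrightarrow>
    (\<forall>d S. compatible_metric X d \<and> pseudo_star_group X S \<and> S \<subseteq> G \<and> generates X S G \<longrightarrow>
      (\<exists>c::real. c > 0 \<and>
        (\<forall>x\<in>topspace X. \<forall>r::real. r > 0 \<longrightarrow>
          (\<exists>s\<in>S. \<exists>y. x \<in> dom s \<and> y \<in> dom s \<and>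
            d x y < ennreal r \<and> d (the (s x)) (the (s y)) \<ge> ennreal c))))"

definition equicontinuous_point ::
  "'a topology \<Rightarrow> ('a \<rightharpoonup> 'a) set \<Rightarrow> ('a \<Rightarrow> 'a \<Rightarrow> ennreal) \<Rightarrow> 'a \<Rightarrow> bool" where
  "equicontinuous_point X S d x \<longleftrightarrow>
    x \<in> topspace X \<and>
    (\<forall>\<epsilon>::real. \<epsilon> > 0 \<longrightarrow> (\<exists>\<delta>::real. \<delta> > 0 \<and>
      (\<forall>s\<in>star_closure X S. \<forall>y. x \<in> dom s \<and> y \<in> dom s \<and> d x y < ennreal \<delta> \<longrightarrow>
        d (the (s x)) (the (s y)) < ennreal \<epsilon>)))"

definition almost_equicontinuous :: "'a topology \<Rightarrow> ('a \<rightharpoonup> 'a) set \<Rightarrow> bool" where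
  "almost_equicontinuous X G \<longleftrightarrow>
    (\<exists>S d. generates X S G \<and> compatible_metric X d \<and>
      X closure_of {x. equicontinuous_point X S d x} = topspace X)"

definition equicontinuous :: "'a topology \<Rightarrow> ('a \<rightharpoonup> 'a) set \<Rightarrow> bool" where
  "equicontinuous X G \<longleftrightarrow>
    (\<exists>S d (\<delta> :: real \<Rightarrow> real).
      pseudo_star_group X S \<and> generates X S G \<and> compatible_metric X d \<and>
      (\<forall>\<epsilon>>0. \<delta> \<epsilon> > 0 \<and>
        (\<forall>s\<in>S. \<forall>x\<in>dom s. \<forall>y\<in>dom s. d x y < ennreal (\<delta> \<epsilon>) \<longrightarrow>
          d (the (s x)) (the (s y)) < ennreal \<epsilon>)))"

end

theory Submission
  imports Defs
begin

text \<open>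
  The exclusive halves are immediate: a sensitivity constant for the metric and the pseudo*group of
  an almost equicontinuous structure contradicts the existence of one equicontinuous point, and
  equicontinuity implies almost equicontinuity. The content is that a pseudogroup which is not
  sensitive is almost equicontinuous, and equicontinuous if it is minimal.

  Failure of sensitivity gives a compatible metric \<open>d\<close> and a generating pseudo*group \<open>S\<close> such that for
  every \<open>c > 0\<close> there are a point \<open>x\<close> and a ball around it in which every point \<open>y\<close> satisfies
  \<open>d (s x) (s y) < c\<close>, for all \<open>s \<in> S\<close> defined at \<open>x\<close> and at \<open>y\<close>. This says little about a neighbour
  \<open>v\<close> of \<open>x\<close>, because the elements of \<open>S\<close> defined at \<open>v\<close> need not be defined at \<open>x\<close>. Compact generation
  repairs this for the compositions of the maps in \<open>F\<close>, called words. By compactness there is a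
  radius \<open>\<delta>\<close> such that every \<open>f \<in> F\<close> extends, from any point of its domain, to an element of \<open>S\<close>
  defined on the whole \<open>\<delta>\<close>-ball. If \<open>c\<close> is small compared with \<open>\<delta>\<close>, the successive images of the ball
  around \<open>x\<close> never grow beyond size \<open>\<delta>\<close>; so every word defined somewhere in that ball extends to an
  element of \<open>S\<close> defined on all of it, and its image has diameter at most \<open>2 * c\<close> (\<open>word_extension\<close>).
  Hence the set of \<open>c\<close>-stable points of \<open>U\<close>, those with a neighbourhood which no word stretches to
  diameter \<open>c\<close>, is non-empty (\<open>exists_stable\<close>). It is open and invariant. Transitivity makes the set of
  points of the space whose orbit meets it open and dense, and by Baire's theorem the points which
  are stable for all \<open>c\<close> are dense. In the minimal case every point of \<open>U\<close> is stable for all \<open>c\<close>.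

  It remains to pass from \<open>U\<close> to the whole, possibly non-compact, space with the same metric,
  truncated at \<open>1\<close>. Cover it by the domains of countably many \<open>h n \<in> G\<close> with values in a compact part of \<open>U\<close>, and cut each
  \<open>h n\<close> into pieces \<open>W\<close>, the charts, subject to two conditions. First, \<open>W\<close> and its image under \<open>h n\<close> have
  diameter less than \<open>1 / (n + 1)\<close>. Secondly, for each \<open>k \<le> n\<close> with \<open>W \<inter> B k \<noteq> {}\<close>, the change of
  coordinates from \<open>h n\<close> to \<open>h k\<close> is a single word on \<open>W\<close>. Looking back only at \<open>k \<le> n\<close> imposes finitely
  many conditions on each chart, and yet relates any two overlapping charts, since one of the two
  indices is the smaller one. The maps which are a word in charts therefore form a pseudo*group; it
  generates \<open>G\<close>. The diameter condition makes the coordinate maps and their inverses uniformly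
  equicontinuous on charts: for given \<open>\<epsilon>\<close> only finitely many \<open>n\<close> matter, and each single \<open>h n\<close> is uniformly
  continuous on a compact set. So equicontinuity of the words on \<open>U\<close>, pointwise or uniform, carries over
  to this pseudo*group on the whole space.
\<close>

section \<open>Partial homeomorphisms and generated pseudogroups\<close>

text \<open>
  The subspaces of the definition disappear because the domain and the image are open: what remains
  is that images and preimages of open sets are open.
\<close>

lemma partial_homeos_iff:
  "f \<in> partial_homeos X \<longleftrightarrow>
     openin X (dom f) \<and> (\<forall>x x' y. f x = Some y \<longrightarrow> f x' = Some y \<longrightarrow> x = x') \<and>
     (\<forall>V. openin X V \<longrightarrow> openin X (pimage f V)) \<and>
     (\<forall>V. openin X V \<longrightarrow> openin X (f -` Some ` V))" (is "?L \<longleftrightarrow> ?R")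
proof
  assume f: ?L
  let ?F = "\<lambda>x. the (f x)"
  have od: "openin X (dom f)" and ora: "openin X (ran f)"
    and h: "homeomorphic_map (subtopology X (dom f)) (subtopology X (ran f)) ?F"
    using f by (auto simp: partial_homeos_def)
  have td: "topspace (subtopology X (dom f)) = dom f" and tr: "topspace (subtopology X (ran f)) = ran f"
    using od ora openin_subset by fastforce+
  have inj: "x = x'" if "f x = Some y" "f x' = Some y" for x x' y
    using homeomorphic_imp_injective_map[OF h] that unfolding td inj_on_def by (metis domI option.sel)
  moreover have "openin X (pimage f V)" if V: "openin X V" for V
  proof -
    have "openin (subtopology X (dom f)) (V \<inter> dom f)"
      using V by (auto simp: openin_subtopology)
    then have "openin (subtopology X (ran f)) (?F ` (V \<inter> dom f))"
      using homeomorphic_imp_open_map[OF h] by (simp add: open_map_def)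
    moreover have "?F ` (V \<inter> dom f) = pimage f V"
      by (force simp: pimage_def)
    ultimately show ?thesis
      using ora openin_open_subtopology by metis
  qed
  moreover have "openin X (f -` Some ` V)" if V: "openin X V" for V
  proof -
    have "openin (subtopology X (ran f)) (V \<inter> ran f)"
      using V by (auto simp: openin_subtopology)
    then have "openin (subtopology X (dom f)) {x \<in> topspace (subtopology X (dom f)). ?F x \<in> V \<inter> ran f}"
      using openin_continuous_map_preimage[OF homeomorphic_imp_continuous_map[OF h]] by blast
    moreover have "{x \<in> topspace (subtopology X (dom f)). ?F x \<in> V \<inter> ran f} = f -` Some ` V"
      unfolding td by (auto simp: ran_def)
    ultimately show ?thesis
      using od openin_open_subtopology by metis
  qed
  ultimately show ?R using od by blast
next
  assume R: ?R
  let ?F = "\<lambda>x. the (f x)"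
  have od: "openin X (dom f)" using R by blast
  have "ran f = pimage f (topspace X)"
    using openin_subset[OF od] by (auto simp: ran_def pimage_def)
  then have ora: "openin X (ran f)" using R by simp
  have td: "topspace (subtopology X (dom f)) = dom f" and tr: "topspace (subtopology X (ran f)) = ran f"
    using od ora openin_subset by fastforce+
  have "homeomorphic_map (subtopology X (dom f)) (subtopology X (ran f)) ?F"
  proof (rule bijective_open_imp_homeomorphic_map)
    show "continuous_map (subtopology X (dom f)) (subtopology X (ran f)) ?F"
      unfolding continuous_map_def td tr
    proof (intro conjI allI impI)
      show "?F \<in> dom f \<rightarrow> ran f" by (auto simp: ran_def)
      fix W assume "openin (subtopology X (ran f)) W"
      then have W: "openin X W" using ora openin_open_subtopology by blast
      have "{x \<in> dom f. ?F x \<in> W} = f -` Some ` W" by auto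
      then show "openin (subtopology X (dom f)) {x \<in> dom f. ?F x \<in> W}"
        using R W od by (auto simp: openin_open_subtopology)
    qed
    show "open_map (subtopology X (dom f)) (subtopology X (ran f)) ?F"
      unfolding open_map_def
    proof (intro allI impI)
      fix W assume "openin (subtopology X (dom f)) W"
      then have W: "openin X W" "W \<subseteq> dom f" using od openin_open_subtopology by blast+
      then have "?F ` W = pimage f W" by (force simp: pimage_def)
      then show "openin (subtopology X (ran f)) (?F ` W)"
        using R W ora by (auto simp: openin_open_subtopology pimage_def ran_def)
    qed
    show "?F ` topspace (subtopology X (dom f)) = topspace (subtopology X (ran f))"
      unfolding td tr by (force simp: ran_def)
    show "inj_on ?F (topspace (subtopology X (dom f)))"
      unfolding td inj_on_def using R by (metis domD option.sel)
  qed
  then show ?L using od ora by (simp add: partial_homeos_def)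
qed

lemma partial_homeo_inj:
  "f \<in> partial_homeos X \<Longrightarrow> f x = Some y \<Longrightarrow> f x' = Some y \<Longrightarrow> x = x'"
  unfolding partial_homeos_iff by blast

lemma partial_homeo_openin_dom: "f \<in> partial_homeos X \<Longrightarrow> openin X (dom f)"
  by (simp add: partial_homeos_def)

lemma partial_homeo_openin_pimage:
  "f \<in> partial_homeos X \<Longrightarrow> openin X V \<Longrightarrow> openin X (pimage f V)"
  unfolding partial_homeos_iff by blast

lemma partial_homeo_openin_vimage:
  "f \<in> partial_homeos X \<Longrightarrow> openin X V \<Longrightarrow> openin X (f -` Some ` V)"
  unfolding partial_homeos_iff by blast

lemma pinv_eq_Some_iff:
  assumes "f \<in> partial_homeos X"
  shows "pinv f y = Some x \<longleftrightarrow> f x = Some y"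
proof -
  have "(THE x. f x = Some y) = x" if "f x = Some y" for x
    using that partial_homeo_inj[OF assms] by blast
  then show ?thesis by (auto simp: pinv_def ran_def)
qed

lemma map_le_iff_Some: "f \<subseteq>\<^sub>m g \<longleftrightarrow> (\<forall>x y. f x = Some y \<longrightarrow> g x = Some y)"
  unfolding map_le_def by (metis domD domI)

lemma restrict_eq_Some_iff: "(f |` A) x = Some y \<longleftrightarrow> x \<in> A \<and> f x = Some y"
  by (simp add: restrict_map_def)

lemma partial_homeo_topspace:
  assumes "f \<in> partial_homeos X" "f x = Some y" shows "x \<in> topspace X" "y \<in> topspace X"
proof -
  show "x \<in> topspace X" using assms(2) openin_subset[OF partial_homeo_openin_dom[OF assms(1)]] by blast
  show "y \<in> topspace X" using assms openin_subset[of X "ran f"]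
    by (auto simp: partial_homeos_def ran_def)
qed

lemma partial_homeo_id: "openin X U \<Longrightarrow> Some |` U \<in> partial_homeos X"
proof -
  assume U: "openin X U"
  have "pimage (Some |` U) V = V \<inter> U" "(Some |` U) -` Some ` V = V \<inter> U" for V
    by (auto simp: pimage_def restrict_map_def split: if_splits)
  moreover have "dom (Some |` U) = U" by auto
  ultimately show ?thesis using U by (auto simp: partial_homeos_iff restrict_eq_Some_iff)
qed

lemma partial_homeo_pinv:
  assumes f: "f \<in> partial_homeos X" shows "pinv f \<in> partial_homeos X"
  unfolding partial_homeos_iff[of "pinv f"]
proof (intro conjI allI impI)
  have im: "pimage (pinv f) V = f -` Some ` V" and pre: "pinv f -` Some ` V = pimage f V" for V
    by (auto simp: pimage_def pinv_eq_Some_iff[OF f] image_iff)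
  have "dom (pinv f) = ran f" by (auto simp: pinv_eq_Some_iff[OF f] ran_def)
  then show "openin X (dom (pinv f))" using f by (simp add: partial_homeos_def)
  show "x = x'" if "pinv f x = Some y" "pinv f x' = Some y" for x x' y
    using that by (simp add: pinv_eq_Some_iff[OF f])
  show "openin X (pimage (pinv f) V)" if "openin X V" for V
    unfolding im by (rule partial_homeo_openin_vimage[OF f that])
  show "openin X (pinv f -` Some ` V)" if "openin X V" for V
    unfolding pre by (rule partial_homeo_openin_pimage[OF f that])
qed

lemma partial_homeo_comp:
  assumes f: "f \<in> partial_homeos X" and g: "g \<in> partial_homeos X"
  shows "g \<circ>\<^sub>m f \<in> partial_homeos X"
  unfolding partial_homeos_iff[of "g \<circ>\<^sub>m f"]
proof (intro conjI allI impI)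
  have dom: "dom (g \<circ>\<^sub>m f) = f -` Some ` dom g"
    by (auto simp: map_comp_Some_iff image_iff)
  have im: "pimage (g \<circ>\<^sub>m f) V = pimage g (pimage f V)" for V
    by (auto simp: pimage_def map_comp_Some_iff)
  have pre: "(g \<circ>\<^sub>m f) -` Some ` V = f -` Some ` (g -` Some ` V)" for V
    by (auto simp: map_comp_Some_iff image_iff)
  show "openin X (dom (g \<circ>\<^sub>m f))"
    unfolding dom by (intro partial_homeo_openin_vimage[OF f] partial_homeo_openin_dom[OF g])
  show "x = x'" if "(g \<circ>\<^sub>m f) x = Some y" "(g \<circ>\<^sub>m f) x' = Some y" for x x' y
    using that partial_homeo_inj[OF f] partial_homeo_inj[OF g]
    unfolding map_comp_Some_iff by blast
  show "openin X (pimage (g \<circ>\<^sub>m f) V)" if "openin X V" for V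
    unfolding im by (intro partial_homeo_openin_pimage[OF g] partial_homeo_openin_pimage[OF f] that)
  show "openin X ((g \<circ>\<^sub>m f) -` Some ` V)" if "openin X V" for V
    unfolding pre by (intro partial_homeo_openin_vimage[OF g] partial_homeo_openin_vimage[OF f] that)
qed

lemma partial_homeo_restrict:
  assumes "f \<in> partial_homeos X" "openin X V" shows "f |` V \<in> partial_homeos X"
proof -
  have "f |` V = f \<circ>\<^sub>m (Some |` V)" by (auto simp: restrict_map_def map_comp_def)
  then show ?thesis using partial_homeo_comp partial_homeo_id assms by metis
qed

lemma pseudo_star_groupD:
  assumes "pseudo_star_group X S"
  shows "f \<in> S \<Longrightarrow> f \<in> partial_homeos X"
    and "f \<in> S \<Longrightarrow> pinv f \<in> S"
    and "f \<in> S \<Longrightarrow> g \<in> S \<Longrightarrow> g \<circ>\<^sub>m f \<in> S"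
  using assms by (auto simp: pseudo_star_group_def)

lemma pseudo_star_group_restrict:
  assumes S: "pseudo_star_group X S" and f: "f \<in> S" and V: "openin X V" shows "f |` V \<in> S"
proof -
  have "f |` V = f |` (V \<inter> dom f)" by (auto simp: restrict_map_def)
  moreover have "openin X (V \<inter> dom f)"
    using partial_homeo_openin_dom[OF pseudo_star_groupD(1)[OF S f]] V by blast
  ultimately show ?thesis using S f by (simp add: pseudo_star_group_def)
qed

lemma pseudo_star_group_id:
  assumes S: "pseudo_star_group X S" and V: "openin X V" shows "Some |` V \<in> S"
proof -
  have "Some |` topspace X |` V \<in> S"
    using S V pseudo_star_group_restrict by (metis pseudo_star_group_def)
  moreover have "topspace X \<inter> V = V" using openin_subset[OF V] by blast
  ultimately show ?thesis by simp
qed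

text \<open>
  The pseudogroup obtained by gluing restrictions of elements of \<open>A\<close>, provided that \<open>A\<close> is closed under
  composition and inversion; \<open>A\<close> does not have to be closed under restriction.
\<close>

definition locally_in :: "'a topology \<Rightarrow> ('a \<rightharpoonup> 'a) set \<Rightarrow> ('a \<rightharpoonup> 'a) set" where
  "locally_in X A = {f \<in> partial_homeos X.
     \<forall>x\<in>dom f. \<exists>V a. openin X V \<and> x \<in> V \<and> a \<in> A \<and> f |` V \<subseteq>\<^sub>m a}"

lemma locally_inI:
  assumes f: "f \<in> partial_homeos X"
    and loc: "\<And>x y. f x = Some y \<Longrightarrow>
      \<exists>V a. openin X V \<and> x \<in> V \<and> a \<in> A \<and> (\<forall>z w. z \<in> V \<longrightarrow> f z = Some w \<longrightarrow> a z = Some w)"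
  shows "f \<in> locally_in X A"
  unfolding locally_in_def
proof (intro CollectI conjI ballI)
  fix x assume "x \<in> dom f"
  then obtain y where "f x = Some y" by blast
  from loc[OF this] show "\<exists>V a. openin X V \<and> x \<in> V \<and> a \<in> A \<and> f |` V \<subseteq>\<^sub>m a"
    by (simp add: map_le_iff_Some restrict_eq_Some_iff imp_conjL)
qed (rule f)

lemma locally_inE:
  assumes "f \<in> locally_in X A" "f x = Some y"
  obtains V a where "openin X V" "x \<in> V" "a \<in> A" "\<forall>z w. z \<in> V \<longrightarrow> f z = Some w \<longrightarrow> a z = Some w"
proof -
  have "x \<in> dom f" using assms(2) by blast
  then obtain V a where V: "openin X V" "x \<in> V" "a \<in> A" "f |` V \<subseteq>\<^sub>m a"
    using assms(1) unfolding locally_in_def by blast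
  show ?thesis
    by (rule that[OF V(1-3)]) (use V(4) in \<open>simp add: map_le_iff_Some restrict_eq_Some_iff\<close>)
qed

lemma subset_locally_in:
  assumes "A \<subseteq> partial_homeos X" shows "A \<subseteq> locally_in X A"
proof
  fix a assume a: "a \<in> A"
  show "a \<in> locally_in X A"
  proof (rule locally_inI)
    show h: "a \<in> partial_homeos X" using a assms by blast
    fix x y assume "a x = Some y"
    then show "\<exists>V b. openin X V \<and> x \<in> V \<and> b \<in> A \<and> (\<forall>z w. z \<in> V \<longrightarrow> a z = Some w \<longrightarrow> b z = Some w)"
      using partial_homeo_openin_dom[OF h] a by (intro exI[of _ "dom a"] exI[of _ a]) auto
  qed
qed

lemma locally_in_partial_homeo: "f \<in> locally_in X A \<Longrightarrow> f \<in> partial_homeos X"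
  by (simp add: locally_in_def)

lemma locally_in_pinv:
  assumes A: "A \<subseteq> partial_homeos X" and inv: "\<And>a. a \<in> A \<Longrightarrow> pinv a \<in> A" and f: "f \<in> locally_in X A"
  shows "pinv f \<in> locally_in X A"
proof (rule locally_inI)
  have h: "f \<in> partial_homeos X" by (rule locally_in_partial_homeo[OF f])
  show "pinv f \<in> partial_homeos X" by (rule partial_homeo_pinv[OF h])
  fix y x assume "pinv f y = Some x"
  then have fx: "f x = Some y" by (simp add: pinv_eq_Some_iff[OF h])
  obtain V a where V: "openin X V" "x \<in> V" "a \<in> A"
    and a: "\<forall>z w. z \<in> V \<longrightarrow> f z = Some w \<longrightarrow> a z = Some w"
    by (rule locally_inE[OF f fx])
  have ah: "a \<in> partial_homeos X" using A V(3) by (rule subsetD)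
  have "openin X (pimage f V)" by (rule partial_homeo_openin_pimage[OF h V(1)])
  moreover have "y \<in> pimage f V" using V(2) fx by (auto simp: pimage_def)
  moreover have "\<forall>z w. z \<in> pimage f V \<longrightarrow> pinv f z = Some w \<longrightarrow> pinv a z = Some w"
  proof (intro allI impI)
    fix z w assume z: "z \<in> pimage f V" "pinv f z = Some w"
    obtain v where v: "v \<in> V" "f v = Some z" using z(1) by (auto simp: pimage_def)
    have "f w = Some z" using z(2) by (simp add: pinv_eq_Some_iff[OF h])
    then have "w = v" by (rule partial_homeo_inj[OF h _ v(2)])
    then have "a w = Some z" using a v by blast
    then show "pinv a z = Some w" by (simp add: pinv_eq_Some_iff[OF ah])
  qed
  ultimately show "\<exists>V a. openin X V \<and> y \<in> V \<and> a \<in> A \<and>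
      (\<forall>z w. z \<in> V \<longrightarrow> pinv f z = Some w \<longrightarrow> a z = Some w)"
    using inv[OF V(3)] by (intro exI[of _ "pimage f V"] exI[of _ "pinv a"] conjI)
qed

lemma locally_in_comp:
  assumes comp: "\<And>a b. a \<in> A \<Longrightarrow> b \<in> A \<Longrightarrow> b \<circ>\<^sub>m a \<in> A"
    and f: "f \<in> locally_in X A" and g: "g \<in> locally_in X A"
  shows "g \<circ>\<^sub>m f \<in> locally_in X A"
proof (rule locally_inI)
  have h: "f \<in> partial_homeos X" by (rule locally_in_partial_homeo[OF f])
  show "g \<circ>\<^sub>m f \<in> partial_homeos X" by (rule partial_homeo_comp[OF h locally_in_partial_homeo[OF g]])
  fix x y assume "(g \<circ>\<^sub>m f) x = Some y"
  then obtain u where u: "f x = Some u" "g u = Some y" by (auto simp: map_comp_Some_iff)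
  obtain V a where V: "openin X V" "x \<in> V" "a \<in> A"
    and a: "\<forall>z w. z \<in> V \<longrightarrow> f z = Some w \<longrightarrow> a z = Some w"
    by (rule locally_inE[OF f u(1)])
  obtain W b where W: "openin X W" "u \<in> W" "b \<in> A"
    and b: "\<forall>z w. z \<in> W \<longrightarrow> g z = Some w \<longrightarrow> b z = Some w"
    by (rule locally_inE[OF g u(2)])
  have "openin X (f -` Some ` W)" by (rule partial_homeo_openin_vimage[OF h W(1)])
  then have "openin X (V \<inter> f -` Some ` W)" using V(1) by blast
  moreover have "x \<in> V \<inter> f -` Some ` W" using V(2) u W(2) by simp
  moreover have "\<forall>z w. z \<in> V \<inter> f -` Some ` W \<longrightarrow> (g \<circ>\<^sub>m f) z = Some w \<longrightarrow> (b \<circ>\<^sub>m a) z = Some w"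
  proof (intro allI impI)
    fix z w assume z: "z \<in> V \<inter> f -` Some ` W" "(g \<circ>\<^sub>m f) z = Some w"
    then obtain v where v: "f z = Some v" "g v = Some w" by (auto simp: map_comp_Some_iff)
    then have "a z = Some v" "b v = Some w" using z(1) a b by auto
    then show "(b \<circ>\<^sub>m a) z = Some w" by simp
  qed
  ultimately show "\<exists>V a. openin X V \<and> x \<in> V \<and> a \<in> A \<and>
      (\<forall>z w. z \<in> V \<longrightarrow> (g \<circ>\<^sub>m f) z = Some w \<longrightarrow> a z = Some w)"
    using comp[OF V(3) W(3)]
    by (intro exI[of _ "V \<inter> f -` Some ` W"] exI[of _ "b \<circ>\<^sub>m a"] conjI)
qed

lemma locally_in_restrict:
  assumes f: "f \<in> locally_in X A" and V: "openin X V"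
  shows "f |` V \<in> locally_in X A"
proof (rule locally_inI)
  show "f |` V \<in> partial_homeos X"
    by (rule partial_homeo_restrict[OF locally_in_partial_homeo[OF f] V])
  fix x y assume "(f |` V) x = Some y"
  then have "f x = Some y" by (simp add: restrict_eq_Some_iff)
  then obtain W a where "openin X W" "x \<in> W" "a \<in> A"
    "\<forall>z w. z \<in> W \<longrightarrow> f z = Some w \<longrightarrow> a z = Some w" by (rule locally_inE[OF f])
  then show "\<exists>W a. openin X W \<and> x \<in> W \<and> a \<in> A \<and>
      (\<forall>z w. z \<in> W \<longrightarrow> (f |` V) z = Some w \<longrightarrow> a z = Some w)"
    by (intro exI[of _ W] exI[of _ a]) (simp add: restrict_eq_Some_iff)
qed

lemma locally_in_glue:
  assumes f: "f \<in> partial_homeos X"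
    and loc: "\<forall>x\<in>dom f. \<exists>U. openin X U \<and> x \<in> U \<and> U \<subseteq> dom f \<and> f |` U \<in> locally_in X A"
  shows "f \<in> locally_in X A"
proof (rule locally_inI[OF f])
  fix x y assume fx: "f x = Some y"
  then obtain U where U: "openin X U" "x \<in> U" "f |` U \<in> locally_in X A" using loc by blast
  have "(f |` U) x = Some y" using fx U(2) by (simp add: restrict_eq_Some_iff)
  then obtain V a where "openin X V" "x \<in> V" "a \<in> A"
    "\<forall>z w. z \<in> V \<longrightarrow> (f |` U) z = Some w \<longrightarrow> a z = Some w"
    by (rule locally_inE[OF U(3)])
  then show "\<exists>V a. openin X V \<and> x \<in> V \<and> a \<in> A \<and> (\<forall>z w. z \<in> V \<longrightarrow> f z = Some w \<longrightarrow> a z = Some w)"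
    using U(1,2)
    by (intro exI[of _ "U \<inter> V"] exI[of _ a]) (simp add: restrict_eq_Some_iff openin_Int)
qed

lemma pseudogroup_locally_in:
  assumes A: "A \<subseteq> partial_homeos X" and id: "Some |` topspace X \<in> A"
    and inv: "\<And>a. a \<in> A \<Longrightarrow> pinv a \<in> A"
    and comp: "\<And>a b. a \<in> A \<Longrightarrow> b \<in> A \<Longrightarrow> b \<circ>\<^sub>m a \<in> A"
  shows "pseudogroup X (locally_in X A)"
  unfolding pseudogroup_def pseudo_star_group_def
proof (intro conjI ballI allI impI)
  show "locally_in X A \<subseteq> partial_homeos X" using locally_in_partial_homeo by (rule subsetI)
  show "Some |` topspace X \<in> locally_in X A"
    using subset_locally_in[OF A] id by (rule subsetD)
  show "pinv f \<in> locally_in X A" if "f \<in> locally_in X A" for f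
    by (rule locally_in_pinv[OF A inv that])
  show "g \<circ>\<^sub>m f \<in> locally_in X A" if "f \<in> locally_in X A" "g \<in> locally_in X A" for f g
    by (rule locally_in_comp[OF comp that])
  show "f |` V \<in> locally_in X A" if "f \<in> locally_in X A" "openin X V \<and> V \<subseteq> dom f" for f V
    using that(1) conjunct1[OF that(2)] by (rule locally_in_restrict)
  show "f \<in> locally_in X A" if "f \<in> partial_homeos X"
    "\<forall>x\<in>dom f. \<exists>U. openin X U \<and> x \<in> U \<and> U \<subseteq> dom f \<and> f |` U \<in> locally_in X A" for f
    using that by (rule locally_in_glue)
qed

lemma pseudogroup_glue:
  assumes H: "pseudogroup X H" and g: "g \<in> partial_homeos X"
    and loc: "\<And>x y. g x = Some y \<Longrightarrow> \<exists>V. openin X V \<and> x \<in> V \<and> g |` V \<in> H"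
  shows "g \<in> H"
proof -
  have loc': "\<forall>x\<in>dom g. \<exists>U. openin X U \<and> x \<in> U \<and> U \<subseteq> dom g \<and> g |` U \<in> H"
  proof
    fix x assume x: "x \<in> dom g"
    then obtain y where y: "g x = Some y" by blast
    obtain V where V: "openin X V" "x \<in> V" "g |` V \<in> H" using loc[OF y] by (elim exE conjE)
    have "g |` (V \<inter> dom g) = g |` V"
      by (rule ext) (auto simp: restrict_map_def domIff)
    moreover have "openin X (V \<inter> dom g)"
      using V(1) partial_homeo_openin_dom[OF g] by (rule openin_Int)
    ultimately show "\<exists>U. openin X U \<and> x \<in> U \<and> U \<subseteq> dom g \<and> g |` U \<in> H"
      using V(2,3) x by (intro exI[of _ "V \<inter> dom g"]) simp
  qed
  have "\<forall>f\<in>partial_homeos X. (\<forall>x\<in>dom f. \<exists>U. openin X U \<and> x \<in> U \<and> U \<subseteq> dom f \<and> f |` U \<in> H)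
      \<longrightarrow> f \<in> H"
    using H unfolding pseudogroup_def by (rule conjunct2)
  from bspec[OF this g] loc' show ?thesis by (rule mp)
qed

lemma pseudo_star_group_star_closure:
  assumes "S \<subseteq> G" "pseudo_star_group X G"
  shows "pseudo_star_group X (star_closure X S)"
  unfolding pseudo_star_group_def[of X "star_closure X S"]
proof (intro conjI ballI allI impI)
  have 1: "S \<subseteq> star_closure X S" by (auto simp: star_closure_def)
  have mem: "f \<in> star_closure X S" if "\<And>T. pseudo_star_group X T \<Longrightarrow> S \<subseteq> T \<Longrightarrow> f \<in> T" for f
    using that by (simp add: star_closure_def)
  have memD: "f \<in> T" if "f \<in> star_closure X S" "pseudo_star_group X T" "S \<subseteq> T" for f T
    using that by (simp add: star_closure_def)
  show "star_closure X S \<subseteq> partial_homeos X"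
    using memD[OF _ assms(2,1)] pseudo_star_groupD(1)[OF assms(2)] by blast
  show "Some |` topspace X \<in> star_closure X S"
    by (rule mem) (simp add: pseudo_star_group_id)
  show "pinv f \<in> star_closure X S" if "f \<in> star_closure X S" for f
    by (rule mem) (simp add: pseudo_star_groupD memD[OF that])
  show "g \<circ>\<^sub>m f \<in> star_closure X S" if "f \<in> star_closure X S" "g \<in> star_closure X S" for f g
    by (rule mem) (simp add: pseudo_star_groupD memD[OF that(1)] memD[OF that(2)])
  show "f |` V \<in> star_closure X S" if "f \<in> star_closure X S" "openin X V \<and> V \<subseteq> dom f" for f V
    by (rule mem) (simp add: pseudo_star_group_restrict memD[OF that(1)] that(2))
qed

lemma generates_star_closure:
  assumes gen: "generates X S G"
  shows "star_closure X S \<subseteq> G" "generates X (star_closure X S) G"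
proof -
  have G: "pseudo_star_group X G" "S \<subseteq> G" using gen by (simp_all add: generates_def pseudogroup_def)
  have S: "S \<subseteq> star_closure X S" by (auto simp: star_closure_def)
  show sub: "star_closure X S \<subseteq> G" using G by (auto simp: star_closure_def)
  have "G \<subseteq> H" if "pseudogroup X H" "star_closure X S \<subseteq> H" for H
    using gen that S unfolding generates_def by (meson order_trans)
  then show "generates X (star_closure X S) G"
    using gen sub by (simp add: generates_def)
qed

lemma star_closure_eq: "pseudo_star_group X S \<Longrightarrow> star_closure X S = S"
  by (auto simp: star_closure_def)

lemma map_eqI: "(\<And>x y. f x = Some y \<longleftrightarrow> g x = Some y) \<Longrightarrow> f = (g :: 'a \<rightharpoonup> 'b)"
  by (rule ext) (metis not_Some_eq)

text \<open>
  Generation, which is defined by minimality, is turned here into a statement about germs: every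
  element of the generated pseudogroup agrees near each point with an element of \<open>A\<close>.
\<close>

lemma generates_locally_in:
  assumes gen: "generates X S G" and A: "A \<subseteq> partial_homeos X" "S \<subseteq> A" "Some |` topspace X \<in> A"
    and inv: "\<And>a. a \<in> A \<Longrightarrow> pinv a \<in> A"
    and comp: "\<And>a b. a \<in> A \<Longrightarrow> b \<in> A \<Longrightarrow> b \<circ>\<^sub>m a \<in> A"
    and g: "g \<in> G"
  shows "g \<in> locally_in X A"
proof -
  have "pseudogroup X (locally_in X A)" by (rule pseudogroup_locally_in[OF A(1,3) inv comp])
  moreover have "S \<subseteq> locally_in X A" using A(2) subset_locally_in[OF A(1)] by (rule order_trans)
  ultimately have "G \<subseteq> locally_in X A" using gen unfolding generates_def by blast
  then show ?thesis using g by (rule subsetD)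
qed

lemma pseudo_star_group_generates_local:
  assumes S: "pseudo_star_group X S" and gen: "generates X S G" and g: "g \<in> G" "g x = Some y"
  obtains V s where "openin X V" "x \<in> V" "s \<in> S" "\<forall>z w. z \<in> V \<longrightarrow> g z = Some w \<longrightarrow> s z = Some w"
proof -
  have "g \<in> locally_in X S"
  proof (rule generates_locally_in[OF gen _ subset_refl])
    show "S \<subseteq> partial_homeos X" using pseudo_star_groupD(1)[OF S] by (rule subsetI)
    show "Some |` topspace X \<in> S" by (rule pseudo_star_group_id[OF S]) simp
  qed (rule pseudo_star_groupD[OF S] g; assumption?)+
  then show thesis using g(2) by (rule locally_inE) (rule that)
qed

lemma partial_homeo_subtopology:
  assumes U: "openin X U" and f: "f \<in> partial_homeos X" "dom f \<subseteq> U" "ran f \<subseteq> U"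
  shows "f \<in> partial_homeos (subtopology X U)"
  unfolding partial_homeos_iff[of f "subtopology X U"] openin_open_subtopology[OF U]
proof (intro conjI allI impI)
  show "openin X (dom f)" by (rule partial_homeo_openin_dom[OF f(1)])
  show "dom f \<subseteq> U" by (rule f(2))
  show "x = x'" if "f x = Some y" "f x' = Some y" for x x' y
    by (rule partial_homeo_inj[OF f(1) that])
  fix V assume V: "openin X V \<and> V \<subseteq> U"
  show "openin X (pimage f V)" using partial_homeo_openin_pimage[OF f(1)] V by blast
  show "openin X (f -` Some ` V)" using partial_homeo_openin_vimage[OF f(1)] V by blast
  show "pimage f V \<subseteq> U" using f(3) by (auto simp: pimage_def ran_def)
  show "f -` Some ` V \<subseteq> U" using f(2) by blast
qed

section \<open>Metrics with infinite values, and compactness\<close>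

text \<open>
  Balls are only a subbase of the topology by definition; the triangle inequality makes them a base.
\<close>

lemma generate_topology_on_ext_balls:
  assumes d: "ext_metric_on M d"
    and gen: "generate_topology_on {{y \<in> M. d x y < ennreal r} | x r. x \<in> M \<and> r > 0} V"
    and "p \<in> V"
  shows "p \<in> M \<and> (\<exists>r>0. {y \<in> M. d p y < ennreal r} \<subseteq> V)"
  using gen \<open>p \<in> V\<close>
proof (induction arbitrary: p)
  case (Int a b)
  then obtain r s where rs: "p \<in> M" "r > 0" "s > 0" "{y \<in> M. d p y < ennreal r} \<subseteq> a"
    "{y \<in> M. d p y < ennreal s} \<subseteq> b" by (meson IntD1 IntD2)
  have "ennreal (min r s) \<le> ennreal r" "ennreal (min r s) \<le> ennreal s" by (auto intro: ennreal_leI)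
  then have "{y \<in> M. d p y < ennreal (min r s)} \<subseteq> a \<inter> b"
    using rs(4,5) by (auto dest: less_le_trans)
  then show ?case using rs(1-3) by (meson min_less_iff_conj)
next
  case (UN K)
  then obtain k where k: "k \<in> K" "p \<in> k" by blast
  with UN.IH[OF k] show ?case by blast
next
  case (Basis s)
  then obtain x R where x: "s = {y \<in> M. d x y < ennreal R}" "x \<in> M" "R > 0" by blast
  then have p: "p \<in> M" "d x p < ennreal R" using Basis.prems by auto
  then obtain q where q: "d x p = ennreal q" "0 \<le> q"
    by (cases "d x p") auto
  have qR: "q < R" using p(2) q x(3) by (simp add: ennreal_less_iff)
  have "{y \<in> M. d p y < ennreal (R - q)} \<subseteq> s"
  proof
    fix y assume y: "y \<in> {y \<in> M. d p y < ennreal (R - q)}"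
    have "d x y \<le> d x p + d p y" using d x(2) p(1) y unfolding ext_metric_on_def by blast
    also have "\<dots> < ennreal q + ennreal (R - q)"
      using y q(1) by (simp add: ennreal_add_left_cancel_less)
    also have "\<dots> = ennreal R" using q(2) qR by (simp flip: ennreal_plus)
    finally show "y \<in> s" using x(1) y by simp
  qed
  then show ?case using p(1) qR by (meson diff_gt_0_iff_gt)
qed simp

text \<open>
  Truncating at \<open>1\<close> gives a real-valued metric with the same small balls. As sensitivity and
  equicontinuity only concern small distances, all arguments below can use real-valued metrics.
\<close>

lemma compatible_metric_truncate:
  assumes cd: "compatible_metric X d"
  obtains m where "Metric_space (topspace X) m" "Metric_space.mtopology (topspace X) m = X"
    "\<And>x y c. x \<in> topspace X \<Longrightarrow> y \<in> topspace X \<Longrightarrow> 0 < c \<Longrightarrow> c \<le> 1 \<Longrightarrow> d x y < ennreal c \<longleftrightarrow> m x y < c"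
proof -
  define M where "M = topspace X"
  define m where "m = (\<lambda>x y. if x \<in> M \<and> y \<in> M then enn2real (min (d x y) 1) else 0)"
  let ?B = "{{y \<in> M. d x y < ennreal r} | x r. x \<in> M \<and> r > 0}"
  have d: "ext_metric_on M d" and XB: "X = topology_generated_by ?B"
    using cd by (simp_all add: compatible_metric_def M_def)
  have em: "ennreal (m x y) = min (d x y) 1" if "x \<in> M" "y \<in> M" for x y
    using that by (auto simp: m_def min_def ennreal_enn2real_if top_unique)
  have less: "d x y < ennreal c \<longleftrightarrow> m x y < c" if "x \<in> M" "y \<in> M" "0 < c" "c \<le> 1" for x y c
  proof -
    have "m x y < c \<longleftrightarrow> ennreal (m x y) < ennreal c"
      using that by (simp add: ennreal_less_iff m_def)
    also have "\<dots> \<longleftrightarrow> d x y < ennreal c"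
      using that unfolding em[OF that(1,2)] by (auto simp: min_less_iff_disj ennreal_less_one_iff)
    finally show ?thesis by simp
  qed
  have nn: "0 \<le> m x y" for x y by (simp add: m_def)
  interpret Metric_space M m
  proof
    show "0 \<le> m x y" for x y by (rule nn)
    show "m x y = m y x" for x y
      using d by (auto simp: m_def ext_metric_on_def)
    show "m x y = 0 \<longleftrightarrow> x = y" if "x \<in> M" "y \<in> M" for x y
    proof -
      have "m x y = 0 \<longleftrightarrow> ennreal (m x y) = 0" by (simp add: m_def)
      also have "\<dots> \<longleftrightarrow> d x y = 0" unfolding em[OF that] by (auto simp: min_def)
      also have "\<dots> \<longleftrightarrow> x = y" using d that by (simp add: ext_metric_on_def)
      finally show ?thesis .
    qed
    show "m x z \<le> m x y + m y z" if "x \<in> M" "y \<in> M" "z \<in> M" for x y z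
    proof -
      have "d x z \<le> d x y + d y z" using d that by (simp add: ext_metric_on_def)
      then have "min (d x z) 1 \<le> min (d x y) 1 + min (d y z) 1"
        by (auto simp: min_def add_increasing add_increasing2 split: if_splits)
      then have "ennreal (m x z) \<le> ennreal (m x y) + ennreal (m y z)"
        by (simp only: em that)
      also have "\<dots> = ennreal (m x y + m y z)"
        by (rule ennreal_plus[symmetric]; rule nn)
      finally show ?thesis
        by (rule ennreal_le_iff[THEN iffD1, rotated]) (intro add_nonneg_nonneg nn)
    qed
  qed
  have "mtopology = X"
    unfolding topology_eq
  proof (intro allI iffI)
    fix V assume V: "openin X V"
    then have gen: "generate_topology_on ?B V" by (intro openin_topology_generated_by) (simp flip: XB)
    show "openin mtopology V"
      unfolding openin_mtopology
    proof (intro conjI allI impI)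
      show "V \<subseteq> M" using V by (simp add: M_def openin_subset)
      fix p assume p: "p \<in> V"
      obtain r where r: "p \<in> M" "r > 0" "{y \<in> M. d p y < ennreal r} \<subseteq> V"
        using generate_topology_on_ext_balls[OF d gen p] by blast
      have "mball p (min r 1) \<subseteq> {y \<in> M. d p y < ennreal (min r 1)}"
        using r(2) less[of p _ "min r 1"] by auto
      also have "\<dots> \<subseteq> {y \<in> M. d p y < ennreal r}"
        using ennreal_leI[of "min r 1" r] by (auto dest: less_le_trans)
      finally show "\<exists>r>0. mball p r \<subseteq> V" using r by (intro exI[of _ "min r 1"]) auto
    qed
  next
    fix V assume V: "openin mtopology V"
    have "\<exists>W. openin X W \<and> p \<in> W \<and> W \<subseteq> V" if p: "p \<in> V" for p
    proof -
      obtain r where r: "r > 0" "mball p r \<subseteq> V" using V p unfolding openin_mtopology by blast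
      have pM: "p \<in> M" using V p openin_mtopology by blast
      let ?W = "{y \<in> M. d p y < ennreal (min r 1)}"
      have "0 < min r 1" using r(1) by simp
      then have "?W \<in> ?B" using pM by blast
      then have "openin X ?W"
        unfolding XB by (rule topology_generated_by_Basis)
      moreover have "d p p = 0" using d pM unfolding ext_metric_on_def by blast
      then have "p \<in> ?W" using pM r(1) by simp
      moreover have "?W \<subseteq> V"
        using r pM less[of p _ "min r 1"] by (intro order_trans[OF _ r(2)]) auto
      ultimately show ?thesis by (intro exI[of _ ?W] conjI)
    qed
    then show "openin X V" by (subst openin_subopen) blast
  qed
  show thesis
    by (rule that[of m, folded M_def, OF Metric_space_axioms \<open>mtopology = X\<close> less])
qed

lemma (in Metric_space) compatible_metric_ennreal:
  "compatible_metric mtopology (\<lambda>x y. ennreal (d x y))"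
proof -
  let ?B = "{{y \<in> M. ennreal (d x y) < ennreal r} | x r. x \<in> M \<and> r > 0}"
  have ball: "{y \<in> M. ennreal (d x y) < ennreal r} = mball x r" if "x \<in> M" for x r
    using that by (auto simp: ennreal_less_iff)
  have "mtopology = topology_generated_by ?B"
    unfolding topology_eq
  proof (intro allI iffI)
    fix V assume V: "openin mtopology V"
    have "\<exists>W. openin (topology_generated_by ?B) W \<and> p \<in> W \<and> W \<subseteq> V" if p: "p \<in> V" for p
    proof -
      obtain r where r: "r > 0" "mball p r \<subseteq> V" "p \<in> M"
        using V p unfolding openin_mtopology by blast
      then have "mball p r \<in> ?B" using ball by blast
      then show ?thesis using r by (intro exI[of _ "mball p r"]) (auto intro: topology_generated_by_Basis)
    qed
    then show "openin (topology_generated_by ?B) V" by (subst openin_subopen) blast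
  next
    fix V assume "openin (topology_generated_by ?B) V"
    then have "generate_topology_on ?B V" by (rule openin_topology_generated_by)
    moreover have "istopology (openin mtopology)" by simp
    moreover have "openin mtopology S" if "S \<in> ?B" for S
      using that by clarify (simp only: ball openin_mball)
    ultimately show "openin mtopology V"
      using generate_topology_on_coarsest by blast
  qed
  moreover have "ext_metric_on M (\<lambda>x y. ennreal (d x y))"
    unfolding ext_metric_on_def
    by (auto simp: commute triangle simp flip: ennreal_plus intro: ennreal_leI)
  ultimately show ?thesis unfolding compatible_metric_def topspace_mtopology by (rule conjI[rotated])
qed

lemma (in Metric_space) Lindelof_space_mtopology:
  assumes "separable_space mtopology" shows "Lindelof_space mtopology"
  unfolding Lindelof_space_alt
proof (intro allI impI)
  fix \<U> assume \<U>: "(\<forall>U\<in>\<U>. openin mtopology U) \<and> topspace mtopology \<subseteq> \<Union>\<U>"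
  obtain D where D: "countable D" "D \<subseteq> M" "mtopology closure_of D = M"
    using assms by (auto simp: separable_space_def)
  define P where "P = {(q, n::nat). q \<in> D \<and> (\<exists>U\<in>\<U>. mball q (1 / Suc n) \<subseteq> U)}"
  have "P \<subseteq> D \<times> UNIV" by (auto simp: P_def)
  then have "countable P" using D(1) by (meson countable_SIGMA countable_subset uncountable_def countableI_type)
  define sel where "sel = (\<lambda>(q, n::nat). SOME U. U \<in> \<U> \<and> mball q (1 / Suc n) \<subseteq> U)"
  have sel: "sel (q, n) \<in> \<U> \<and> mball q (1 / Suc n) \<subseteq> sel (q, n)" if "(q, n) \<in> P" for q n
  proof -
    have "\<exists>U. U \<in> \<U> \<and> mball q (1 / Suc n) \<subseteq> U" using that by (auto simp: P_def)
    then show ?thesis unfolding sel_def prod.case by (rule someI_ex)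
  qed
  have "topspace mtopology \<subseteq> \<Union>(sel ` P)"
  proof
    fix x assume "x \<in> topspace mtopology"
    then have x: "x \<in> M" by simp
    then obtain U where U: "U \<in> \<U>" "x \<in> U" using \<U> by auto
    then obtain r where r: "r > 0" "mball x r \<subseteq> U" using \<U> unfolding openin_mtopology by blast
    obtain n where n: "1 / Suc n < r / 2" using r(1) nat_approx_posE half_gt_zero by metis
    have "x \<in> mtopology closure_of D" using x D(3) by simp
    then obtain q where q: "q \<in> D" "q \<in> mball x (1 / Suc n)"
      unfolding metric_closure_of by (auto dest!: spec[of _ "1 / real (Suc n)"])
    have "mball q (1 / Suc n) \<subseteq> mball x r"
      using q(2) n by (intro mball_subset) (auto simp: commute)
    then have P: "(q, n) \<in> P" using q(1) U(1) r(2) by (auto simp: P_def)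
    have "x \<in> mball q (1 / Suc n)" using q(2) by (auto simp: commute)
    then show "x \<in> \<Union>(sel ` P)" using sel[OF P] P by blast
  qed
  moreover have "sel ` P \<subseteq> \<U>" using sel by auto
  ultimately show "\<exists>\<V>. countable \<V> \<and> \<V> \<subseteq> \<U> \<and> topspace mtopology \<subseteq> \<Union>\<V>"
    using countable_image[OF \<open>countable P\<close>, of sel] by (intro exI[of _ "sel ` P"] conjI)
qed

text \<open>
  Lebesgue's covering lemma for a cover given by a property \<open>Q\<close>. All uniform choices in the
  proof (extension radii, moduli of continuity, stability radii) are instances.
\<close>

lemma (in Metric_space) Lebesgue_number_compactin:
  assumes K: "compactin mtopology K"
    and cov: "\<And>x. x \<in> K \<Longrightarrow> \<exists>V. openin mtopology V \<and> x \<in> V \<and> Q V"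
  obtains \<delta> where "\<delta> > 0" "\<And>x. x \<in> K \<Longrightarrow> \<exists>V. Q V \<and> mball x \<delta> \<subseteq> V"
proof -
  have "\<exists>r>0. \<exists>V. Q V \<and> mball x (2 * r) \<subseteq> V" if x: "x \<in> K" for x
  proof -
    obtain V where V: "openin mtopology V" "x \<in> V" "Q V" using cov[OF x] by blast
    then obtain r where "r > 0" "mball x r \<subseteq> V" unfolding openin_mtopology by blast
    then show ?thesis using V(3) by (intro exI[of _ "r/2"]) auto
  qed
  then obtain r where r: "\<And>x. x \<in> K \<Longrightarrow> r x > 0" "\<And>x. x \<in> K \<Longrightarrow> \<exists>V. Q V \<and> mball x (2 * r x) \<subseteq> V"
    by metis
  have KM: "K \<subseteq> M" using K compactin_subset_topspace by fastforce
  have cover: "K \<subseteq> \<Union>((\<lambda>x. mball x (r x)) ` K)" using r(1) KM by force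
  have "\<exists>\<F>. finite \<F> \<and> \<F> \<subseteq> (\<lambda>x. mball x (r x)) ` K \<and> K \<subseteq> \<Union>\<F>"
    using cover by (intro compactinD[OF K]) auto
  then obtain \<F> where \<F>: "finite \<F>" "\<F> \<subseteq> (\<lambda>x. mball x (r x)) ` K" "K \<subseteq> \<Union>\<F>" by blast
  obtain A where A: "A \<subseteq> K" "finite A" "\<F> = (\<lambda>x. mball x (r x)) ` A"
    using finite_subset_image[OF \<F>(1,2)] by blast
  define \<delta> where "\<delta> = Min (insert 1 (r ` A))"
  have "\<delta> > 0" using A(1,2) r(1) by (auto simp: \<delta>_def Min_gr_iff)
  moreover have "\<exists>V. Q V \<and> mball x \<delta> \<subseteq> V" if x: "x \<in> K" for x
  proof -
    obtain a where a: "a \<in> A" "x \<in> mball a (r a)" using A(3) \<F>(3) x by blast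
    have "\<delta> \<le> r a" using A(2) a(1) by (simp add: \<delta>_def)
    then have "mball x \<delta> \<subseteq> mball a (2 * r a)"
      using a(2) by (intro mball_subset) (auto simp: commute)
    then show ?thesis using r(2)[of a] a(1) A(1) by blast
  qed
  ultimately show thesis by (rule that)
qed

section \<open>Words in the generators\<close>

text \<open>
  The compositions of elements of \<open>F\<close>, without restriction to smaller domains: a word keeps its
  natural domain, so that it is a global object to which an extension statement can apply.
\<close>

inductive_set words :: "'a set \<Rightarrow> ('a \<rightharpoonup> 'a) set \<Rightarrow> ('a \<rightharpoonup> 'a) set" for U F where
  words_id: "Some |` U \<in> words U F"
| words_step: "w \<in> words U F \<Longrightarrow> f \<in> F \<Longrightarrow> f \<circ>\<^sub>m w \<in> words U F"

text \<open>
  What the charts need to know about the set of words. Beyond these properties, induction over words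
  is needed only for the extension lemma.
\<close>

locale word_system =
  fixes X :: "'a topology" and G :: "('a \<rightharpoonup> 'a) set" and U :: "'a set" and Wd :: "('a \<rightharpoonup> 'a) set"
  assumes pg: "pseudogroup X G" and openin_U: "openin X U"
    and word_in_G: "w \<in> Wd \<Longrightarrow> w \<in> G"
    and word_in_U: "w \<in> Wd \<Longrightarrow> w x = Some y \<Longrightarrow> x \<in> U \<and> y \<in> U"
    and word_id: "Some |` U \<in> Wd"
    and word_inv: "w \<in> Wd \<Longrightarrow> pinv w \<in> Wd"
    and word_comp: "w \<in> Wd \<Longrightarrow> w' \<in> Wd \<Longrightarrow> w' \<circ>\<^sub>m w \<in> Wd"
    and restrict_local_word: "g \<in> pg_restrict G U \<Longrightarrow> g x = Some y \<Longrightarrow>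
      \<exists>V w. openin X V \<and> x \<in> V \<and> w \<in> Wd \<and> (\<forall>z z'. z \<in> V \<longrightarrow> g z = Some z' \<longrightarrow> w z = Some z')"
begin

lemma star_G: "pseudo_star_group X G" using pg by (simp add: pseudogroup_def)

lemmas G_homeo = pseudo_star_groupD(1)[OF star_G]
  and G_inv = pseudo_star_groupD(2)[OF star_G]
  and G_comp = pseudo_star_groupD(3)[OF star_G]
  and G_restrict = pseudo_star_group_restrict[OF star_G]

lemma local_word:
  assumes g: "g \<in> G" "g x = Some y" "x \<in> U" "y \<in> U"
  obtains V w where "openin X V" "x \<in> V" "w \<in> Wd" "V \<subseteq> U"
    "\<forall>z z'. z \<in> V \<longrightarrow> g z = Some z' \<longrightarrow> w z = Some z'"
proof -
  define N where "N = U \<inter> g -` Some ` U"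
  have N: "openin X N" unfolding N_def
    by (intro openin_Int openin_U partial_homeo_openin_vimage[OF G_homeo[OF g(1)] openin_U])
  have xN: "x \<in> N" using g(2-4) by (simp add: N_def)
  have gN: "g |` N \<in> pg_restrict G U"
    using G_restrict[OF g(1) N] by (auto simp: pg_restrict_def N_def ran_def restrict_eq_Some_iff)
  have "(g |` N) x = Some y" using xN g(2) by simp
  from restrict_local_word[OF gN this] obtain V w where V: "openin X V" "x \<in> V" "w \<in> Wd"
    "\<forall>z z'. z \<in> V \<longrightarrow> (g |` N) z = Some z' \<longrightarrow> w z = Some z'"
    by blast
  show thesis
  proof (rule that)
    show "openin X (V \<inter> N)" using V(1) N by (rule openin_Int)
    show "x \<in> V \<inter> N" using V(2) xN by simp
    show "w \<in> Wd" by (rule V(3))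
    show "V \<inter> N \<subseteq> U" by (auto simp: N_def)
    show "\<forall>z z'. z \<in> V \<inter> N \<longrightarrow> g z = Some z' \<longrightarrow> w z = Some z'"
      using V(4) by (simp add: restrict_eq_Some_iff)
  qed
qed

end

lemma word_system_words:
  assumes pg: "pseudogroup X G" and U: "openin X U"
    and F: "F \<subseteq> pg_restrict G U" "symmetric_maps F"
    and gen: "generates (subtopology X U) F (pg_restrict G U)"
  shows "word_system X G U (words U F)"
proof -
  have star: "pseudo_star_group X G" using pg by (simp add: pseudogroup_def)
  have G: "w \<in> G \<and> (\<forall>x y. w x = Some y \<longrightarrow> x \<in> U \<and> y \<in> U)" if "w \<in> words U F" for w
    using that
  proof induction
    case words_id
    show ?case using pseudo_star_group_id[OF star U] by (simp add: restrict_eq_Some_iff)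
  next
    case (words_step w f)
    have f: "f \<in> G" "dom f \<subseteq> U" "ran f \<subseteq> U" using F(1) words_step(2) by (auto simp: pg_restrict_def)
    have "f \<circ>\<^sub>m w \<in> G" using words_step(3) f(1) pseudo_star_groupD(3)[OF star] by blast
    then show ?case using words_step(3) f(2,3) by (auto simp: map_comp_Some_iff ran_def)
  qed
  have homeo: "w \<in> partial_homeos X" if "w \<in> words U F" for w
    using G[OF that] pseudo_star_groupD(1)[OF star] by blast
  have comp: "w' \<circ>\<^sub>m w \<in> words U F" if "w' \<in> words U F" "w \<in> words U F" for w w'
    using that(1)
  proof induction
    case words_id
    have "(Some |` U) \<circ>\<^sub>m w = w"
      using G[OF that(2)] by (intro map_eqI) (auto simp: map_comp_Some_iff restrict_eq_Some_iff)
    then show ?case using that(2) by simp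
  next
    case (words_step w' f)
    have "(f \<circ>\<^sub>m w') \<circ>\<^sub>m w = f \<circ>\<^sub>m (w' \<circ>\<^sub>m w)"
      by (intro map_eqI) (auto simp: map_comp_Some_iff)
    then show ?case using words.words_step[OF words_step(3) words_step(2)] by simp
  qed
  have FW: "f \<in> words U F" if f: "f \<in> F" for f
  proof -
    have "dom f \<subseteq> U" using f F(1) by (auto simp: pg_restrict_def)
    then have "f \<circ>\<^sub>m (Some |` U) = f"
      by (intro map_eqI) (auto simp: map_comp_Some_iff restrict_eq_Some_iff)
    then show ?thesis using words.words_step[OF words.words_id[of U F] f] by simp
  qed
  have inv: "pinv w \<in> words U F" if "w \<in> words U F" for w
    using that
  proof induction
    case words_id
    have "pinv (Some |` U) = Some |` U"
      by (intro map_eqI)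
        (auto simp: pinv_eq_Some_iff[OF partial_homeo_id[OF U]] restrict_eq_Some_iff)
    then show ?case by (simp add: words.words_id)
  next
    case (words_step w f)
    have hf: "f \<in> partial_homeos X" by (rule homeo[OF FW[OF words_step(2)]])
    have hw: "w \<in> partial_homeos X" by (rule homeo[OF words_step(1)])
    have "pinv (f \<circ>\<^sub>m w) = pinv w \<circ>\<^sub>m pinv f"
      by (intro map_eqI) (auto simp: map_comp_Some_iff pinv_eq_Some_iff[OF hf]
          pinv_eq_Some_iff[OF hw] pinv_eq_Some_iff[OF partial_homeo_comp[OF hw hf]])
    moreover have "pinv f \<in> F" using F(2) words_step(2) by (simp add: symmetric_maps_def)
    ultimately show ?case using comp[OF words_step(3) FW] by simp
  qed
  show ?thesis
  proof
    show "pseudogroup X G" by (rule pg)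
    show "openin X U" by (rule U)
    show "w \<in> G" if "w \<in> words U F" for w using G[OF that] by blast
    show "x \<in> U \<and> y \<in> U" if "w \<in> words U F" "w x = Some y" for w x y using G[OF that(1)] that(2) by blast
    show "Some |` U \<in> words U F" by (rule words_id)
    show "pinv w \<in> words U F" if "w \<in> words U F" for w by (rule inv[OF that])
    show "w' \<circ>\<^sub>m w \<in> words U F" if "w \<in> words U F" "w' \<in> words U F" for w w' by (rule comp[OF that(2,1)])
    fix g x y assume g: "g \<in> pg_restrict G U" "g x = Some y"
    have ts: "topspace (subtopology X U) = U" using openin_subset[OF U] by auto
    have "g \<in> locally_in (subtopology X U) (words U F)"
    proof (rule generates_locally_in[OF gen])
      show "words U F \<subseteq> partial_homeos (subtopology X U)"
      proof
        fix w assume w: "w \<in> words U F"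
        show "w \<in> partial_homeos (subtopology X U)"
          by (rule partial_homeo_subtopology[OF U homeo[OF w]]) (use G[OF w] in \<open>auto simp: ran_def\<close>)
      qed
      show "F \<subseteq> words U F" using FW by (rule subsetI)
      show "Some |` topspace (subtopology X U) \<in> words U F" unfolding ts by (rule words_id)
      show "pinv w \<in> words U F" if "w \<in> words U F" for w by (rule inv[OF that])
      show "w' \<circ>\<^sub>m w \<in> words U F" if "w \<in> words U F" "w' \<in> words U F" for w w' by (rule comp[OF that(2,1)])
      show "g \<in> pg_restrict G U" by (rule g(1))
    qed
    then obtain V w where V: "openin (subtopology X U) V" "x \<in> V" "w \<in> words U F"
      "\<forall>z z'. z \<in> V \<longrightarrow> g z = Some z' \<longrightarrow> w z = Some z'"
      using g(2) by (rule locally_inE)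
    have "openin X V" using V(1) by (simp add: openin_open_subtopology[OF U])
    with V show "\<exists>V w. openin X V \<and> x \<in> V \<and> w \<in> words U F \<and> (\<forall>z z'. z \<in> V \<longrightarrow> g z = Some z' \<longrightarrow> w z = Some z')"
      by (intro exI[of _ V] exI[of _ w] conjI)
  qed
qed

locale metric_word_system = Metric_space M d + word_system "Metric_space.mtopology M d" G U Wd
  for M :: "'a set" and d G U Wd
begin

text \<open>
  Only pairs of points in the domain of the word are compared, but the word need not be defined at
  \<open>v\<close>. This is what makes stability an open condition.
\<close>

definition stable :: "real \<Rightarrow> 'a \<Rightarrow> bool" where
  "stable c v \<longleftrightarrow> v \<in> U \<and> (\<exists>N. openin mtopology N \<and> v \<in> N \<and>
     (\<forall>w\<in>Wd. \<forall>y\<in>N. \<forall>z\<in>N. \<forall>y' z'. w y = Some y' \<longrightarrow> w z = Some z' \<longrightarrow> d y' z' < c))"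

lemma stableI:
  assumes "v \<in> U" "openin mtopology N" "v \<in> N"
    and "\<And>w y z y' z'. w \<in> Wd \<Longrightarrow> y \<in> N \<Longrightarrow> z \<in> N \<Longrightarrow> w y = Some y' \<Longrightarrow> w z = Some z' \<Longrightarrow> d y' z' < c"
  shows "stable c v"
  unfolding stable_def
  by (intro conjI exI[of _ N] ballI allI impI assms(1-3)) (erule (4) assms(4))

lemma openin_stable: "openin mtopology {v. stable c v}"
proof (subst openin_subopen, intro ballI)
  fix v assume "v \<in> {v. stable c v}"
  then obtain N where v: "v \<in> U" and N: "openin mtopology N" "v \<in> N"
    "\<forall>w\<in>Wd. \<forall>y\<in>N. \<forall>z\<in>N. \<forall>y' z'. w y = Some y' \<longrightarrow> w z = Some z' \<longrightarrow> d y' z' < c"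
    unfolding stable_def by blast
  have "U \<inter> N \<subseteq> {v. stable c v}"
  proof
    fix u assume "u \<in> U \<inter> N"
    then show "u \<in> {v. stable c v}" unfolding stable_def using N by blast
  qed
  then show "\<exists>T. openin mtopology T \<and> v \<in> T \<and> T \<subseteq> {v. stable c v}"
    using v N(1,2) openin_U by (intro exI[of _ "U \<inter> N"] conjI) auto
qed

text \<open>
  Near \<open>v\<close> the map \<open>g\<close> is a word \<open>u\<close>, and composing with \<open>u\<close> turns words at \<open>v'\<close> into words at \<open>v\<close>.
\<close>

lemma stable_invariant:
  assumes st: "stable c v" and g: "g \<in> G" "g v = Some v'" "v' \<in> U"
  shows "stable c v'"
proof -
  obtain N where v: "v \<in> U" and N: "openin mtopology N" "v \<in> N"
    and c: "\<forall>w\<in>Wd. \<forall>y\<in>N. \<forall>z\<in>N. \<forall>y' z'. w y = Some y' \<longrightarrow> w z = Some z' \<longrightarrow> d y' z' < c"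
    using st unfolding stable_def by blast
  obtain V u where V: "openin mtopology V" "v \<in> V" "u \<in> Wd"
    "\<forall>z z'. z \<in> V \<longrightarrow> g z = Some z' \<longrightarrow> u z = Some z'"
    by (rule local_word[OF g(1,2) v g(3)])
  have u: "u v = Some v'" using V(2,4) g(2) by blast
  show ?thesis
  proof (rule stableI)
    show "v' \<in> U" by (rule g(3))
    show "openin mtopology (pimage u N)"
      by (rule partial_homeo_openin_pimage[OF G_homeo[OF word_in_G[OF V(3)]] N(1)])
    show "v' \<in> pimage u N" using u N(2) by (auto simp: pimage_def)
    show "d y' z' < c"
      if w: "w \<in> Wd" "y \<in> pimage u N" "z \<in> pimage u N" "w y = Some y'" "w z = Some z'" for w y z y' z'
    proof -
      obtain a b where ab: "a \<in> N" "u a = Some y" "b \<in> N" "u b = Some z"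
        using w(2,3) by (auto simp: pimage_def)
      have "w \<circ>\<^sub>m u \<in> Wd" by (rule word_comp[OF V(3) w(1)])
      moreover have "(w \<circ>\<^sub>m u) a = Some y'" "(w \<circ>\<^sub>m u) b = Some z'" using ab w(4,5) by simp_all
      ultimately show ?thesis using c ab(1,3) by blast
    qed
  qed
qed

end

section \<open>Stable points of a pseudogroup that is not sensitive\<close>

context Metric_space begin

text \<open>
  The role of compact generation. The hypothesis \<open>st\<close> on the centre \<open>x\<close> bounds the image of \<open>N\<close> under any
  element of \<open>S\<close> defined on all of \<open>N\<close>. When one more letter \<open>f\<close> is appended, this image lies within
  \<open>2 * c \<le> \<delta>\<close> of a point of \<open>dom f\<close>, where the extension \<open>t\<close> of \<open>f\<close> is defined; so the
  composition is again defined on all of \<open>N\<close>, in particular at \<open>x\<close>, and the bound persists.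
\<close>

lemma word_extension:
  assumes S: "pseudo_star_group mtopology S"
    and ext: "\<forall>f\<in>F. \<forall>p\<in>dom f.
      \<exists>t\<in>S. \<forall>z\<in>mball p \<delta>. z \<in> dom t \<and> (\<forall>w. f z = Some w \<longrightarrow> t z = Some w)"
    and N: "openin mtopology N" "x \<in> N" and c: "2 * c \<le> \<delta>"
    and st: "\<And>s y x' y'. s \<in> S \<Longrightarrow> y \<in> N \<Longrightarrow> s x = Some x' \<Longrightarrow> s y = Some y' \<Longrightarrow> d x' y' < c"
    and w: "w \<in> words U F" and v: "v \<in> N" "w v = Some v'"
  shows "\<exists>s\<in>S. dom s = N \<and> (\<forall>y\<in>N. \<forall>z. w y = Some z \<longrightarrow> s y = Some z)"
  using w v(2)
proof (induction arbitrary: v')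
  case words_id
  have "Some |` N \<in> S" by (rule pseudo_star_group_id[OF S N(1)])
  then show ?case by (rule bexI[rotated]) (auto simp: restrict_eq_Some_iff)
next
  case (words_step w f)
  then obtain u where u: "w v = Some u" "f u = Some v'" by (auto simp: map_comp_Some_iff)
  obtain s where s: "s \<in> S" "dom s = N" "\<forall>y\<in>N. \<forall>z. w y = Some z \<longrightarrow> s y = Some z"
    using words_step.IH[OF u(1)] by blast
  obtain t where t: "t \<in> S" "\<forall>z\<in>mball u \<delta>. z \<in> dom t \<and> (\<forall>w. f z = Some w \<longrightarrow> t z = Some w)"
    using ext words_step.hyps(2) u(2) by blast
  have hs: "s \<in> partial_homeos mtopology" by (rule pseudo_star_groupD(1)[OF S s(1)])
  have su: "s v = Some u" using s(3) v(1) u(1) by blast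
  obtain x' where x': "s x = Some x'" using N(2) s(2) by blast
  have M: "b \<in> M" if "s a = Some b" for a b
    using partial_homeo_topspace(2)[OF hs that] by simp
  have ball: "y' \<in> mball u \<delta>" if y: "s y = Some y'" for y y'
  proof -
    have "y \<in> N" using y s(2) by blast
    have "d u y' \<le> d x' u + d x' y'" using triangle''[OF M[OF su] M[OF x'] M[OF y]] by (simp add: commute)
    also have "\<dots> < c + c"
      by (intro add_strict_mono st[OF s(1) v(1) x' su] st[OF s(1) \<open>y \<in> N\<close> x' y])
    finally show ?thesis using c M[OF su] M[OF y] by simp
  qed
  have "t \<circ>\<^sub>m s \<in> S" by (rule pseudo_star_groupD(3)[OF S s(1) t(1)])
  moreover have "dom (t \<circ>\<^sub>m s) = N"
  proof
    show "dom (t \<circ>\<^sub>m s) \<subseteq> N" using s(2) by (auto simp: map_comp_Some_iff)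
    show "N \<subseteq> dom (t \<circ>\<^sub>m s)"
    proof
      fix y assume "y \<in> N"
      then obtain y' where y': "s y = Some y'" using s(2) by blast
      then show "y \<in> dom (t \<circ>\<^sub>m s)" using t(2) ball[OF y'] by (simp add: domIff)
    qed
  qed
  moreover have "(t \<circ>\<^sub>m s) y = Some z" if y: "y \<in> N" "(f \<circ>\<^sub>m w) y = Some z" for y z
  proof -
    obtain a where a: "w y = Some a" "f a = Some z" using y(2) by (auto simp: map_comp_Some_iff)
    have "s y = Some a" using s(3) y(1) a(1) by blast
    then show ?thesis using t(2) ball a(2) by simp
  qed
  ultimately show ?case by blast
qed

text \<open>
  The maps \<open>e f\<close> are the given extensions of the generators. Near each point of the compact set
  \<open>mtopology closure_of dom f\<close> they agree with elements of \<open>S\<close>, and the finitely many Lebesgue numbers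
  have a positive minimum.
\<close>

lemma extension_radius:
  assumes S: "pseudo_star_group mtopology S" and gen: "generates mtopology S G"
    and U: "compactin mtopology (mtopology closure_of U)"
    and F: "finite F" "\<forall>f\<in>F. dom f \<subseteq> U"
    and e: "\<forall>f\<in>F. e f \<in> G \<and> f \<subseteq>\<^sub>m e f \<and> mtopology closure_of dom f \<subseteq> dom (e f)"
  obtains \<delta> where "\<delta> > 0" "\<forall>f\<in>F. \<forall>p\<in>dom f.
      \<exists>t\<in>S. \<forall>z\<in>mball p \<delta>. z \<in> dom t \<and> (\<forall>w. f z = Some w \<longrightarrow> t z = Some w)"
proof -
  have one: "\<exists>\<delta>>0. \<forall>p\<in>dom f. \<exists>t\<in>S. \<forall>z\<in>mball p \<delta>. z \<in> dom t \<and> (\<forall>w. f z = Some w \<longrightarrow> t z = Some w)"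
    if f: "f \<in> F" for f
  proof -
    let ?Q = "\<lambda>V. \<exists>t\<in>S. \<forall>z\<in>V. z \<in> dom t \<and> (\<forall>w. f z = Some w \<longrightarrow> t z = Some w)"
    have efG: "e f \<in> G" and fe: "f \<subseteq>\<^sub>m e f" and cl: "mtopology closure_of dom f \<subseteq> dom (e f)"
      using e f by blast+
    have "pseudo_star_group mtopology G" using gen by (simp add: generates_def pseudogroup_def)
    then have he: "e f \<in> partial_homeos mtopology" using efG by (rule pseudo_star_groupD(1))
    have "compactin mtopology (mtopology closure_of dom f)"
      by (rule closed_compactin[OF U closure_of_mono[OF bspec[OF F(2) f]] closedin_closure_of])
    then obtain \<delta> where \<delta>: "\<delta> > 0" "\<And>p. p \<in> mtopology closure_of dom f \<Longrightarrow> \<exists>V. ?Q V \<and> mball p \<delta> \<subseteq> V"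
    proof (rule Lebesgue_number_compactin)
      fix p assume p: "p \<in> mtopology closure_of dom f"
      then obtain q where q: "e f p = Some q" using cl by blast
      obtain V s where V: "openin mtopology V" "p \<in> V" "s \<in> S"
        "\<forall>z w. z \<in> V \<longrightarrow> e f z = Some w \<longrightarrow> s z = Some w"
        by (rule pseudo_star_group_generates_local[OF S gen efG q])
      have "openin mtopology (V \<inter> dom (e f))"
        by (rule openin_Int[OF V(1) partial_homeo_openin_dom[OF he]])
      moreover have "p \<in> V \<inter> dom (e f)" using V(2) q by blast
      moreover have "\<forall>z\<in>V \<inter> dom (e f). z \<in> dom s \<and> (\<forall>w. f z = Some w \<longrightarrow> s z = Some w)"
        using V(4) fe unfolding map_le_iff_Some by blast
      ultimately show "\<exists>V. openin mtopology V \<and> p \<in> V \<and> ?Q V" using V(3) by blast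
    qed blast
    have "dom f \<subseteq> M" using he fe
      by (metis map_le_implies_dom_le openin_subset partial_homeo_openin_dom subset_trans topspace_mtopology)
    then have "dom f \<subseteq> mtopology closure_of dom f" by (simp add: closure_of_subset)
    then show ?thesis using \<delta> by (meson subsetD)
  qed
  then obtain D where D: "\<And>f. f \<in> F \<Longrightarrow> D f > 0 \<and> (\<forall>p\<in>dom f. \<exists>t\<in>S. \<forall>z\<in>mball p (D f).
      z \<in> dom t \<and> (\<forall>w. f z = Some w \<longrightarrow> t z = Some w))" by metis
  show thesis
  proof (rule that)
    show "Min (insert 1 (D ` F)) > 0" using F(1) D by (auto simp: Min_gr_iff)
    show "\<forall>f\<in>F. \<forall>p\<in>dom f. \<exists>t\<in>S. \<forall>z\<in>mball p (Min (insert 1 (D ` F))).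
        z \<in> dom t \<and> (\<forall>w. f z = Some w \<longrightarrow> t z = Some w)"
    proof (intro ballI)
      fix f p assume f: "f \<in> F" "p \<in> dom f"
      have "mball p (Min (insert 1 (D ` F))) \<subseteq> mball p (D f)"
        using F(1) f(1) by (intro mball_subset_concentric) simp
      then show "\<exists>t\<in>S. \<forall>z\<in>mball p (Min (insert 1 (D ` F))). z \<in> dom t \<and> (\<forall>w. f z = Some w \<longrightarrow> t z = Some w)"
        using D[OF f(1)] f(2) by (meson subsetD)
    qed
  qed
qed

end

text \<open>
  A point with the non-sensitivity property is moved into \<open>U\<close> by an element of \<open>S\<close>, which
  preserves this property because \<open>S\<close> is closed under composition. There the extension lemma applies.
\<close>

lemma (in metric_word_system) exists_stable:
  assumes Wd: "Wd = words U F"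
    and S: "pseudo_star_group mtopology S" and gen: "generates mtopology S G"
    and \<delta>: "\<delta> > 0" and ext: "\<forall>f\<in>F. \<forall>p\<in>dom f.
      \<exists>t\<in>S. \<forall>z\<in>mball p \<delta>. z \<in> dom t \<and> (\<forall>w. f z = Some w \<longrightarrow> t z = Some w)"
    and orb: "\<forall>x\<in>M. orbit_of G x \<inter> U \<noteq> {}"
    and nonsens: "\<forall>c>0. \<exists>x\<in>M. \<exists>r>0. \<forall>s\<in>S. \<forall>y x' y'. s x = Some x' \<longrightarrow> s y = Some y' \<longrightarrow>
       d x y < r \<longrightarrow> d x' y' < c"
    and c: "c > 0"
  shows "\<exists>u. stable c u"
proof -
  \<comment> \<open>Half of \<open>\<delta>\<close> for the extension lemma, half of \<open>c\<close> to pass from distances to the centre to diameters.\<close>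
  define c' where "c' = min c \<delta> / 2"
  have c': "c' > 0" "2 * c' \<le> \<delta>" "2 * c' \<le> c" using c \<delta> by (auto simp: c'_def)
  obtain x r where x: "x \<in> M" "r > 0"
    and st: "\<And>s y x' y'. s \<in> S \<Longrightarrow> s x = Some x' \<Longrightarrow> s y = Some y' \<Longrightarrow> d x y < r \<Longrightarrow> d x' y' < c'"
    using nonsens c'(1) by meson
  obtain g u where g: "g \<in> G" "g x = Some u" "u \<in> U"
    using bspec[OF orb x(1)] by (auto simp: orbit_of_def)
  obtain V s where V: "openin mtopology V" "x \<in> V" "s \<in> S"
    "\<forall>z w. z \<in> V \<longrightarrow> g z = Some w \<longrightarrow> s z = Some w"
    by (rule pseudo_star_group_generates_local[OF S gen g(1,2)])
  have sx: "s x = Some u" using V(2,4) g(2) by blast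
  define N where "N = pimage s (mball x r)"
  have N: "openin mtopology N" unfolding N_def
    by (rule partial_homeo_openin_pimage[OF pseudo_star_groupD(1)[OF S V(3)] openin_mball])
  have uN: "u \<in> N" using sx x by (auto simp: N_def pimage_def)
  have stu: "d x' y' < c'" if t: "t \<in> S" "y \<in> N" "t u = Some x'" "t y = Some y'" for t y x' y'
  proof -
    obtain z where z: "z \<in> mball x r" "s z = Some y" using t(2) by (auto simp: N_def pimage_def)
    have "t \<circ>\<^sub>m s \<in> S" by (rule pseudo_star_groupD(3)[OF S V(3) t(1)])
    moreover have "(t \<circ>\<^sub>m s) x = Some x'" "(t \<circ>\<^sub>m s) z = Some y'" using sx z(2) t(3,4) by simp_all
    ultimately show ?thesis using st z(1) by simp
  qed
  have "d y' z' < c" if w: "w \<in> Wd" "y \<in> N" "z \<in> N" "w y = Some y'" "w z = Some z'" for w y z y' z'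
  proof -
    have "\<exists>t\<in>S. dom t = N \<and> (\<forall>a\<in>N. \<forall>b. w a = Some b \<longrightarrow> t a = Some b)"
      by (rule word_extension[OF S ext N uN c'(2) _ w(1)[unfolded Wd] w(2,4)]) (erule (3) stu)
    then obtain t where t: "t \<in> S" "dom t = N" "\<forall>a\<in>N. \<forall>b. w a = Some b \<longrightarrow> t a = Some b"
      by blast
    obtain u' where u': "t u = Some u'" using uN t(2) by blast
    have ty: "t y = Some y'" "t z = Some z'" using t(3) w by blast+
    have M: "b \<in> M" if "t a = Some b" for a b
      using partial_homeo_topspace(2)[OF pseudo_star_groupD(1)[OF S t(1)] that] by simp
    have "d y' z' \<le> d u' y' + d u' z'"
      using triangle''[OF M[OF ty(1)] M[OF u'] M[OF ty(2)]] by (simp add: commute)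
    also have "\<dots> < c' + c'"
      by (intro add_strict_mono stu[OF t(1) w(2) u' ty(1)] stu[OF t(1) w(3) u' ty(2)])
    finally show ?thesis using c'(3) by simp
  qed
  then have "stable c u" by (rule stableI[OF g(3) N uN])
  then show ?thesis ..
qed

section \<open>Charts and the pseudo*group they define\<close>

lemma pimage_compactin:
  assumes f: "f \<in> partial_homeos X" and C: "compactin X C" "C \<subseteq> dom f"
  shows "compactin X (pimage f C)"
proof -
  have "homeomorphic_map (subtopology X (dom f)) (subtopology X (ran f)) (\<lambda>x. the (f x))"
    using f by (simp add: partial_homeos_def)
  then have "continuous_map (subtopology X (dom f)) X (\<lambda>x. the (f x))"
    using homeomorphic_imp_continuous_map continuous_map_in_subtopology by blast
  moreover have "compactin (subtopology X (dom f)) C"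
    using C by (simp add: compactin_subtopology)
  ultimately have "compactin X ((\<lambda>x. the (f x)) ` C)" by (rule image_compactin[rotated])
  moreover have "(\<lambda>x. the (f x)) ` C = pimage f C"
    using C(2) by (force simp: pimage_def)
  ultimately show ?thesis by simp
qed

lemma (in Metric_space) partial_homeo_uniformly_continuous:
  assumes f: "f \<in> partial_homeos mtopology" and C: "compactin mtopology C" "C \<subseteq> dom f" and "\<epsilon> > 0"
  shows "\<exists>\<delta>>0. \<forall>x\<in>C. \<forall>y\<in>C. d x y < \<delta> \<longrightarrow> d (the (f x)) (the (f y)) < \<epsilon>"
proof -
  let ?Q = "\<lambda>V. \<forall>a\<in>V. \<forall>b\<in>V. d (the (f a)) (the (f b)) < \<epsilon>"
  have CM: "C \<subseteq> M" using compactin_subset_topspace[OF C(1)] by simp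
  obtain \<delta> where \<delta>: "\<delta> > 0" "\<And>x. x \<in> C \<Longrightarrow> \<exists>V. ?Q V \<and> mball x \<delta> \<subseteq> V"
  proof (rule Lebesgue_number_compactin[OF C(1)])
    fix x assume "x \<in> C"
    then obtain x' where x': "f x = Some x'" using C(2) by blast
    have x'M: "x' \<in> M" using partial_homeo_topspace(2)[OF f x'] by simp
    let ?V = "f -` Some ` mball x' (\<epsilon> / 2)"
    have "openin mtopology ?V" by (rule partial_homeo_openin_vimage[OF f openin_mball])
    moreover have "x \<in> ?V" using x' x'M \<open>\<epsilon> > 0\<close> by simp
    moreover have "?Q ?V"
    proof (intro ballI)
      fix a b assume "a \<in> ?V" "b \<in> ?V"
      then obtain a' b' where ab: "f a = Some a'" "a' \<in> mball x' (\<epsilon> / 2)" "f b = Some b'" "b' \<in> mball x' (\<epsilon> / 2)"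
        by auto
      have "d a' b' \<le> d x' a' + d x' b'" using ab x'M by (intro triangle'') auto
      then show "d (the (f a)) (the (f b)) < \<epsilon>" using ab by simp
    qed
    ultimately show "\<exists>V. openin mtopology V \<and> x \<in> V \<and> ?Q V" by (intro exI[of _ ?V] conjI)
  qed blast
  have "d (the (f x)) (the (f y)) < \<epsilon>" if xy: "x \<in> C" "y \<in> C" "d x y < \<delta>" for x y
  proof -
    obtain V where V: "?Q V" "mball x \<delta> \<subseteq> V" using \<delta>(2)[OF xy(1)] by (elim exE conjE)
    have "x \<in> mball x \<delta>" "y \<in> mball x \<delta>" using xy CM \<delta>(1) by auto
    then show ?thesis using V by blast
  qed
  then show ?thesis using \<delta>(1) by (intro exI[of _ \<delta>] conjI ballI impI)
qed

text \<open>
  Each \<open>B n\<close> lies in a compact subset \<open>C n\<close> of \<open>dom (h n)\<close>. This provides the uniform continuity of \<open>h n\<close>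
  on \<open>B n\<close>, and it lets a point of the boundary of \<open>B k\<close> still have coordinates with respect to \<open>h k\<close>.
\<close>

locale charts = metric_word_system M d G U Wd
  for M :: "'a set" and d G U Wd +
  fixes h :: "nat \<Rightarrow> 'a \<rightharpoonup> 'a" and B C :: "nat \<Rightarrow> 'a set"
  assumes h_in_G: "h n \<in> G" and h_in_U: "h n x = Some y \<Longrightarrow> y \<in> U"
    and openin_B: "openin mtopology (B n)" and B_subset_C: "B n \<subseteq> C n"
    and compactin_C: "compactin mtopology (C n)" and C_subset_dom: "C n \<subseteq> dom (h n)"
    and B_cover: "x \<in> M \<Longrightarrow> \<exists>n. x \<in> B n"
begin

definition coord :: "nat \<Rightarrow> 'a \<Rightarrow> 'a" where
  "coord n x = the (h n x)"

text \<open>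
  The bound \<open>1 / Suc n\<close> makes all but finitely many indices irrelevant for a given \<open>\<epsilon>\<close>. The last
  condition looks back at smaller indices only; so it can be met by a finite intersection of
  neighbourhoods although the cover by the \<open>B n\<close> is not locally finite.
\<close>

definition chart :: "nat \<Rightarrow> 'a set \<Rightarrow> bool" where
  "chart n W \<longleftrightarrow> openin mtopology W \<and> W \<subseteq> B n \<and>
     (\<forall>x\<in>W. \<forall>y\<in>W. d x y < 1 / Suc n \<and> d (coord n x) (coord n y) < 1 / Suc n) \<and>
     (\<forall>k\<le>n. W \<inter> B k = {} \<or>
        (\<exists>w\<in>Wd. \<forall>z\<in>W. h k z = Some (coord k z) \<and> w (coord n z) = Some (coord k z)))"

lemma h_homeo: "h n \<in> partial_homeos mtopology" by (rule G_homeo[OF h_in_G])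

lemma h_coord_C: "x \<in> C n \<Longrightarrow> h n x = Some (coord n x)"
  using C_subset_dom[of n] by (auto simp: coord_def)

lemma h_coord: "x \<in> B n \<Longrightarrow> h n x = Some (coord n x)"
  by (rule h_coord_C[OF subsetD[OF B_subset_C]])

lemma chart_subset: "chart n W \<Longrightarrow> x \<in> W \<Longrightarrow> x \<in> B n"
  by (auto simp: chart_def)

text \<open>
  Either \<open>x\<close> is outside the closed set \<open>C k\<close>, and a neighbourhood misses \<open>B k\<close>; or \<open>x\<close> is in the domain of
  \<open>h k\<close>, and the coordinate change is an element of \<open>G\<close> between points of \<open>U\<close>, hence locally a word.
\<close>

lemma exists_transition:
  assumes x: "x \<in> B n"
  shows "\<exists>W. openin mtopology W \<and> x \<in> W \<and> (W \<inter> B k = {} \<or>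
     (\<exists>w\<in>Wd. \<forall>z\<in>W. h k z = Some (coord k z) \<and> w (coord n z) = Some (coord k z)))"
proof (cases "x \<in> C k")
  case False
  have "closedin mtopology (C k)"
    by (rule compactin_imp_closedin[OF Hausdorff_space_mtopology compactin_C])
  then have "openin mtopology (M - C k)" by (simp add: closedin_def)
  moreover have "x \<in> M - C k"
    using False openin_subset[OF openin_B[of n]] x by auto
  moreover have "(M - C k) \<inter> B k = {}" using B_subset_C[of k] by blast
  ultimately show ?thesis by (intro exI[of _ "M - C k"] conjI disjI1)
next
  case True
  have hk: "h k x = Some (coord k x)" by (rule h_coord_C[OF True])
  have hn: "h n x = Some (coord n x)" by (rule h_coord[OF x])
  have "h k \<circ>\<^sub>m pinv (h n) \<in> G" by (rule G_comp[OF G_inv[OF h_in_G] h_in_G])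
  moreover have "(h k \<circ>\<^sub>m pinv (h n)) (coord n x) = Some (coord k x)"
    using hk hn by (simp add: map_comp_Some_iff pinv_eq_Some_iff[OF h_homeo])
  ultimately obtain V w where V: "openin mtopology V" "coord n x \<in> V" "w \<in> Wd"
    "\<forall>z z'. z \<in> V \<longrightarrow> (h k \<circ>\<^sub>m pinv (h n)) z = Some z' \<longrightarrow> w z = Some z'"
    by (rule local_word[OF _ _ h_in_U[OF hn] h_in_U[OF hk]])
  let ?W = "dom (h k) \<inter> h n -` Some ` V"
  have "openin mtopology ?W"
    by (intro openin_Int partial_homeo_openin_dom[OF h_homeo] partial_homeo_openin_vimage[OF h_homeo V(1)])
  moreover have "x \<in> ?W" using hk hn V(2) by auto
  moreover have "\<exists>w\<in>Wd. \<forall>z\<in>?W. h k z = Some (coord k z) \<and> w (coord n z) = Some (coord k z)"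
  proof (rule bexI[OF _ V(3)], rule ballI)
    fix z assume z: "z \<in> ?W"
    obtain v v' where v: "h n z = Some v" "v \<in> V" "h k z = Some v'" using z by auto
    have "(h k \<circ>\<^sub>m pinv (h n)) v = Some v'"
      using v by (simp add: map_comp_Some_iff pinv_eq_Some_iff[OF h_homeo])
    then have "w v = Some v'" using V(4) v(2) by blast
    then show "h k z = Some (coord k z) \<and> w (coord n z) = Some (coord k z)"
      using v(1,3) by (simp add: coord_def)
  qed
  ultimately show ?thesis by (intro exI[of _ ?W] conjI disjI2)
qed

lemma exists_chart:
  assumes x: "x \<in> B n" shows "\<exists>W. x \<in> W \<and> chart n W"
proof -
  define good where "good k W \<longleftrightarrow> (W \<inter> B k = {} \<or>
     (\<exists>w\<in>Wd. \<forall>z\<in>W. h k z = Some (coord k z) \<and> w (coord n z) = Some (coord k z)))" for k W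
  obtain R where R: "\<And>k. openin mtopology (R k)" "\<And>k. x \<in> R k" "\<And>k. good k (R k)"
    using exists_transition[OF x] unfolding good_def by metis
  have mono: "good k W" if "good k W'" "W \<subseteq> W'" for k W W'
    using that unfolding good_def by blast
  let ?r = "1 / (2 * real (Suc n))"
  let ?W = "B n \<inter> (\<Inter>k\<le>n. R k) \<inter> mball x ?r \<inter> h n -` Some ` mball (coord n x) ?r"
  have r: "?r > 0" and rr: "?r + ?r = 1 / Suc n" by (simp_all add: field_simps)
  have hx: "h n x = Some (coord n x)" by (rule h_coord[OF x])
  have xM: "x \<in> M" "coord n x \<in> M" using partial_homeo_topspace[OF h_homeo hx] by simp_all
  have "chart n ?W"
    unfolding chart_def
  proof (intro conjI ballI allI impI)
    show "openin mtopology ?W"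
      by (intro openin_Int openin_B openin_mball partial_homeo_openin_vimage[OF h_homeo]
          openin_INT2) (auto intro: R(1))
    show "?W \<subseteq> B n" by blast
    fix y z assume yz: "y \<in> ?W" "z \<in> ?W"
    have "d y z \<le> d x y + d x z" using yz by (intro triangle'') auto
    also have "\<dots> < ?r + ?r" using yz by (intro add_strict_mono) auto
    finally show "d y z < 1 / Suc n" unfolding rr .
    have c: "coord n y \<in> mball (coord n x) ?r" "coord n z \<in> mball (coord n x) ?r"
      using yz by (auto simp: coord_def)
    then have "d (coord n y) (coord n z) \<le> d (coord n x) (coord n y) + d (coord n x) (coord n z)"
      by (intro triangle'') auto
    also have "\<dots> < ?r + ?r" using c by (intro add_strict_mono) auto
    finally show "d (coord n y) (coord n z) < 1 / Suc n" unfolding rr .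
  next
    fix k assume "k \<le> n"
    then have "?W \<subseteq> R k" by blast
    from mono[OF R(3) this] show "?W \<inter> B k = {} \<or>
      (\<exists>w\<in>Wd. \<forall>z\<in>?W. h k z = Some (coord k z) \<and> w (coord n z) = Some (coord k z))"
      unfolding good_def .
  qed
  moreover have "x \<in> ?W" using x R(2) r xM hx by simp
  ultimately show ?thesis by (intro exI[of _ ?W] conjI)
qed

lemma chart_transition_le:
  assumes "chart n W" "k \<le> n" "W \<inter> B k \<noteq> {}"
  shows "\<exists>w\<in>Wd. \<forall>z\<in>W. w (coord n z) = Some (coord k z)"
proof -
  have "\<exists>w\<in>Wd. \<forall>z\<in>W. h k z = Some (coord k z) \<and> w (coord n z) = Some (coord k z)"
    using assms unfolding chart_def by blast
  then show ?thesis by blast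
qed

text \<open>
  The chart with the larger index knows the change to the other one, possibly up to inversion.
\<close>

lemma chart_transition:
  assumes W: "chart n W" and V: "chart k V" and ne: "W \<inter> V \<noteq> {}"
  obtains w where "w \<in> Wd" "\<forall>z\<in>W \<inter> V. w (coord n z) = Some (coord k z)"
proof (cases "k \<le> n")
  case True
  have "W \<inter> B k \<noteq> {}" using ne chart_subset[OF V] by blast
  from chart_transition_le[OF W True this] obtain w
    where "w \<in> Wd" "\<forall>z\<in>W. w (coord n z) = Some (coord k z)" by blast
  then show thesis by (intro that[of w]) simp_all
next
  case False
  have ne': "V \<inter> B n \<noteq> {}" using ne chart_subset[OF W] by blast
  have "n \<le> k" using False by simp
  from chart_transition_le[OF V this ne'] obtain w
    where w: "w \<in> Wd" "\<forall>z\<in>V. w (coord k z) = Some (coord n z)" by blast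
  show thesis
  proof (rule that)
    show "pinv w \<in> Wd" by (rule word_inv[OF w(1)])
    show "\<forall>z\<in>W \<inter> V. pinv w (coord n z) = Some (coord k z)"
      using w(2) by (simp add: pinv_eq_Some_iff[OF G_homeo[OF word_in_G[OF w(1)]]])
  qed
qed

text \<open>
  In the coordinates of the two charts, \<open>f\<close> is a restriction of the word \<open>w\<close>.
\<close>

definition linked :: "('a \<rightharpoonup> 'a) \<Rightarrow> nat \<Rightarrow> 'a set \<Rightarrow> nat \<Rightarrow> 'a set \<Rightarrow> ('a \<rightharpoonup> 'a) \<Rightarrow> bool" where
  "linked f n W k V w \<longleftrightarrow> chart n W \<and> chart k V \<and> w \<in> Wd \<and>
     (\<forall>x y. f x = Some y \<longrightarrow> x \<in> W \<and> y \<in> V \<and> w (coord n x) = Some (coord k y))"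

text \<open>
  The partial identities are added because a pseudo*group contains the identity of the
  whole space, and a single chart need not contain the whole space.
\<close>

definition charted_maps :: "('a \<rightharpoonup> 'a) set" where
  "charted_maps = {f \<in> G. (\<forall>x y. f x = Some y \<longrightarrow> y = x) \<or> (\<exists>n W k V w. linked f n W k V w)}"

lemma charted_maps_cases:
  assumes "f \<in> charted_maps"
  obtains (identity) "f \<in> G" "\<forall>x y. f x = Some y \<longrightarrow> y = x"
  | (linked) n W k V w where "f \<in> G" "linked f n W k V w"
  using assms unfolding charted_maps_def by blast

lemma charted_maps_submap:
  assumes f: "f \<in> charted_maps" and g: "g \<in> G" "\<forall>x y. g x = Some y \<longrightarrow> f x = Some y"
  shows "g \<in> charted_maps"
  using f
proof (cases rule: charted_maps_cases)
  case identity
  then show ?thesis using g unfolding charted_maps_def by blast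
next
  case (linked n W k V w)
  then have "linked g n W k V w" using g(2) unfolding linked_def by blast
  then show ?thesis using g(1) unfolding charted_maps_def by blast
qed

lemma charted_maps_inv:
  assumes "f \<in> charted_maps" shows "pinv f \<in> charted_maps"
  using assms
proof (cases rule: charted_maps_cases)
  case identity
  have "\<forall>x y. pinv f x = Some y \<longrightarrow> y = x"
    using identity(2) by (auto simp: pinv_eq_Some_iff[OF G_homeo[OF identity(1)]])
  then show ?thesis using G_inv[OF identity(1)] unfolding charted_maps_def by blast
next
  case (linked n W k V w)
  then have l: "chart n W" "chart k V" "w \<in> Wd"
    "\<forall>x y. f x = Some y \<longrightarrow> x \<in> W \<and> y \<in> V \<and> w (coord n x) = Some (coord k y)"
    unfolding linked_def by blast+
  have "linked (pinv f) k V n W (pinv w)"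
    unfolding linked_def
    using l word_inv[OF l(3)] by (simp add: pinv_eq_Some_iff[OF G_homeo[OF linked(1)]]
        pinv_eq_Some_iff[OF G_homeo[OF word_in_G[OF l(3)]]])
  then show ?thesis using G_inv[OF linked(1)] unfolding charted_maps_def by blast
qed

text \<open>
  If the charts in the middle are disjoint, the composition is empty; otherwise the transition
  between them is a word and can be absorbed.
\<close>

lemma charted_maps_comp:
  assumes f: "f \<in> charted_maps" and g: "g \<in> charted_maps" shows "g \<circ>\<^sub>m f \<in> charted_maps"
proof -
  have fG: "f \<in> G" and gG: "g \<in> G" using f g by (simp_all add: charted_maps_def)
  have gf: "g \<circ>\<^sub>m f \<in> G" by (rule G_comp[OF fG gG])
  show ?thesis
    using f
  proof (cases rule: charted_maps_cases)
    case identity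
    show ?thesis
      by (rule charted_maps_submap[OF g gf]) (use identity(2) in \<open>auto simp: map_comp_Some_iff\<close>)
  next
    case f: (linked n W k V w)
    show ?thesis
      using g
    proof (cases rule: charted_maps_cases)
      case identity
      show ?thesis
        by (rule charted_maps_submap[OF assms(1) gf]) (use identity(2) in \<open>auto simp: map_comp_Some_iff\<close>)
    next
      case g: (linked n' W' k' V' w')
      have lf: "chart n W" "chart k V" "w \<in> Wd"
        "\<forall>x y. f x = Some y \<longrightarrow> x \<in> W \<and> y \<in> V \<and> w (coord n x) = Some (coord k y)"
        using f(2) unfolding linked_def by blast+
      have lg: "chart n' W'" "chart k' V'" "w' \<in> Wd"
        "\<forall>x y. g x = Some y \<longrightarrow> x \<in> W' \<and> y \<in> V' \<and> w' (coord n' x) = Some (coord k' y)"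
        using g(2) unfolding linked_def by blast+
      show ?thesis
      proof (cases "V \<inter> W' = {}")
        case True
        have "\<forall>x y. (g \<circ>\<^sub>m f) x = Some y \<longrightarrow> y = x"
          using True lf(4) lg(4) unfolding map_comp_Some_iff by blast
        then show ?thesis using gf unfolding charted_maps_def by blast
      next
        case False
        obtain u where u: "u \<in> Wd" "\<forall>z\<in>V \<inter> W'. u (coord k z) = Some (coord n' z)"
          by (rule chart_transition[OF lf(2) lg(1) False])
        have "w' \<circ>\<^sub>m (u \<circ>\<^sub>m w) \<in> Wd" by (intro word_comp lf(3) lg(3) u(1))
        moreover have "x \<in> W \<and> y \<in> V' \<and> (w' \<circ>\<^sub>m (u \<circ>\<^sub>m w)) (coord n x) = Some (coord k' y)"
          if xy: "(g \<circ>\<^sub>m f) x = Some y" for x y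
        proof -
          obtain z where z: "f x = Some z" "g z = Some y" using xy by (auto simp: map_comp_Some_iff)
          have "x \<in> W" "z \<in> V" "w (coord n x) = Some (coord k z)" using lf(4) z(1) by blast+
          moreover have "z \<in> W'" "y \<in> V'" "w' (coord n' z) = Some (coord k' y)" using lg(4) z(2) by blast+
          ultimately show ?thesis using u(2) by simp
        qed
        ultimately have "linked (g \<circ>\<^sub>m f) n W k' V' (w' \<circ>\<^sub>m (u \<circ>\<^sub>m w))"
          unfolding linked_def using lf(1) lg(2) by blast
        then show ?thesis using gf unfolding charted_maps_def by blast
      qed
    qed
  qed
qed

lemma pseudo_star_group_charted_maps: "pseudo_star_group mtopology charted_maps"
  unfolding pseudo_star_group_def
proof (intro conjI ballI allI impI)
  show "charted_maps \<subseteq> partial_homeos mtopology" using G_homeo by (auto simp: charted_maps_def)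
  have "Some |` topspace mtopology \<in> G" by (rule pseudo_star_group_id[OF star_G openin_topspace])
  then show "Some |` topspace mtopology \<in> charted_maps" by (simp add: charted_maps_def restrict_eq_Some_iff)
  show "pinv f \<in> charted_maps" if "f \<in> charted_maps" for f by (rule charted_maps_inv[OF that])
  show "g \<circ>\<^sub>m f \<in> charted_maps" if "f \<in> charted_maps" "g \<in> charted_maps" for f g by (rule charted_maps_comp[OF that])
  show "f |` V \<in> charted_maps" if f: "f \<in> charted_maps" and V: "openin mtopology V \<and> V \<subseteq> dom f" for f V
  proof (rule charted_maps_submap[OF f])
    have "f \<in> G" using f by (simp add: charted_maps_def)
    then show "f |` V \<in> G" by (rule G_restrict) (use V in blast)
  qed (simp add: restrict_eq_Some_iff)
qed

text \<open>
  Read in charts around \<open>x\<close> and \<open>y\<close>, the germ of \<open>g\<close> lies in the restriction of \<open>G\<close> to \<open>U\<close> and so is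
  the germ of a word.
\<close>

lemma G_locally_charted:
  assumes g: "g \<in> G" "g x = Some y"
  shows "\<exists>V. openin mtopology V \<and> x \<in> V \<and> g |` V \<in> charted_maps"
proof -
  have "x \<in> M" "y \<in> M" using partial_homeo_topspace[OF G_homeo[OF g(1)] g(2)] by simp_all
  then obtain n k where nk: "x \<in> B n" "y \<in> B k" using B_cover by meson
  obtain W W' where W: "x \<in> W" "chart n W" "y \<in> W'" "chart k W'"
    using exists_chart[OF nk(1)] exists_chart[OF nk(2)] by (elim exE conjE)
  have hx: "h n x = Some (coord n x)" and hy: "h k y = Some (coord k y)"
    by (rule h_coord, fact nk)+
  let ?\<gamma> = "h k \<circ>\<^sub>m (g \<circ>\<^sub>m pinv (h n))"
  have "?\<gamma> \<in> G" by (intro G_comp G_inv h_in_G g(1))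
  moreover have "?\<gamma> (coord n x) = Some (coord k y)"
    using hx hy g(2) by (simp add: map_comp_Some_iff pinv_eq_Some_iff[OF h_homeo])
  ultimately obtain V w where V: "openin mtopology V" "coord n x \<in> V" "w \<in> Wd"
    "\<forall>z z'. z \<in> V \<longrightarrow> ?\<gamma> z = Some z' \<longrightarrow> w z = Some z'"
    by (rule local_word[OF _ _ h_in_U[OF hx] h_in_U[OF hy]])
  let ?N = "W \<inter> g -` Some ` W' \<inter> h n -` Some ` V"
  have "openin mtopology W" "openin mtopology W'" using W(2,4) by (simp_all add: chart_def)
  then have N: "openin mtopology ?N"
    by (intro openin_Int partial_homeo_openin_vimage[OF h_homeo V(1)]
        partial_homeo_openin_vimage[OF G_homeo[OF g(1)]])
  have "linked (g |` ?N) n W k W' w"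
    unfolding linked_def
  proof (intro conjI allI impI W(2,4) V(3))
    fix a b assume "(g |` ?N) a = Some b"
    then have ab: "a \<in> ?N" "g a = Some b" by (auto simp: restrict_eq_Some_iff simp del: restrict_in)
    show "a \<in> W" using ab(1) by blast
    show bW: "b \<in> W'" using ab by auto
    have "h n a = Some (coord n a)" by (rule h_coord[OF chart_subset[OF W(2) \<open>a \<in> W\<close>]])
    moreover have "h k b = Some (coord k b)" by (rule h_coord[OF chart_subset[OF W(4) bW]])
    ultimately have "?\<gamma> (coord n a) = Some (coord k b)" "coord n a \<in> V"
      using ab by (auto simp: map_comp_Some_iff pinv_eq_Some_iff[OF h_homeo])
    then show "w (coord n a) = Some (coord k b)" using V(4) by blast
  qed
  moreover have "g |` ?N \<in> G" by (rule G_restrict[OF g(1) N])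
  ultimately have "g |` ?N \<in> charted_maps" unfolding charted_maps_def by blast
  moreover have "x \<in> ?N" using W g(2) hx V(2) by simp
  ultimately show ?thesis using N by (intro exI[of _ ?N] conjI)
qed

lemma generates_charted_maps: "generates mtopology charted_maps G"
  unfolding generates_def
proof (intro conjI allI impI)
  show "pseudogroup mtopology G" by (rule pg)
  show "charted_maps \<subseteq> G" by (auto simp: charted_maps_def)
  fix H assume H: "pseudogroup mtopology H \<and> charted_maps \<subseteq> H"
  show "G \<subseteq> H"
  proof
    fix g assume g: "g \<in> G"
    show "g \<in> H"
    proof (rule pseudogroup_glue)
      show "pseudogroup mtopology H" using H by blast
      show "g \<in> partial_homeos mtopology" by (rule G_homeo[OF g])
      fix x y assume "g x = Some y"
      from G_locally_charted[OF g this] show "\<exists>V. openin mtopology V \<and> x \<in> V \<and> g |` V \<in> H"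
        using H by blast
    qed
  qed
qed

text \<open>
  For \<open>1 / Suc n < \<epsilon>\<close> nothing has to be shown, and finitely many indices remain.
\<close>

lemma uniform_in_charts:
  assumes each: "\<And>n. \<exists>\<delta>>0. \<forall>x\<in>B n. \<forall>y\<in>B n. a n x y < \<delta> \<longrightarrow> b n x y < \<epsilon>"
    and small: "\<And>n W x y. chart n W \<Longrightarrow> x \<in> W \<Longrightarrow> y \<in> W \<Longrightarrow> b n x y < 1 / Suc n"
    and "(\<epsilon>::real) > 0"
  shows "\<exists>\<delta>>(0::real). \<forall>n W x y. chart n W \<longrightarrow> x \<in> W \<longrightarrow> y \<in> W \<longrightarrow> a n x y < \<delta> \<longrightarrow> b n x y < \<epsilon>"
proof -
  obtain N where N: "1 / real (Suc N) < \<epsilon>" using nat_approx_posE[OF \<open>\<epsilon> > 0\<close>] by metis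
  obtain D where D: "\<And>n. D n > 0" "\<And>n. \<forall>x\<in>B n. \<forall>y\<in>B n. a n x y < D n \<longrightarrow> b n x y < \<epsilon>"
    using each by metis
  let ?\<delta> = "Min (D ` {..N})"
  have "b n x y < \<epsilon>" if c: "chart n W" "x \<in> W" "y \<in> W" "a n x y < ?\<delta>" for n W x y
  proof (cases "n \<le> N")
    case True
    then have "?\<delta> \<le> D n" by simp
    with c(4) have "a n x y < D n" by (rule less_le_trans)
    then show ?thesis using D(2) chart_subset[OF c(1)] c(2,3) by blast
  next
    case False
    have "b n x y < 1 / Suc n" by (rule small[OF c(1-3)])
    also have "\<dots> \<le> 1 / Suc N" using False by (simp add: frac_le)
    finally show ?thesis using N by simp
  qed
  moreover have "?\<delta> > 0" using D(1) by (simp add: Min_gr_iff)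
  ultimately show ?thesis by (intro exI[of _ ?\<delta>] conjI allI impI)
qed

lemma coord_uniformly_equicontinuous:
  assumes "\<epsilon> > 0"
  shows "\<exists>\<delta>>0. \<forall>n W x y. chart n W \<longrightarrow> x \<in> W \<longrightarrow> y \<in> W \<longrightarrow> d x y < \<delta> \<longrightarrow> d (coord n x) (coord n y) < \<epsilon>"
proof (rule uniform_in_charts[OF _ _ assms])
  fix n
  show "\<exists>\<delta>>0. \<forall>x\<in>B n. \<forall>y\<in>B n. d x y < \<delta> \<longrightarrow> d (coord n x) (coord n y) < \<epsilon>"
    using partial_homeo_uniformly_continuous[OF h_homeo compactin_C C_subset_dom assms, of n] B_subset_C[of n]
    unfolding coord_def by blast
qed (auto simp: chart_def)

lemma inverse_coord_uniformly_equicontinuous: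
  assumes "\<epsilon> > 0"
  shows "\<exists>\<delta>>0. \<forall>n W x y. chart n W \<longrightarrow> x \<in> W \<longrightarrow> y \<in> W \<longrightarrow> d (coord n x) (coord n y) < \<delta> \<longrightarrow> d x y < \<epsilon>"
proof (rule uniform_in_charts[OF _ _ assms])
  fix n
  let ?K = "pimage (h n) (C n)"
  have K: "compactin mtopology ?K" by (rule pimage_compactin[OF h_homeo compactin_C C_subset_dom])
  have "?K \<subseteq> dom (pinv (h n))"
    by (auto simp: pimage_def dom_def pinv_eq_Some_iff[OF h_homeo])
  from partial_homeo_uniformly_continuous[OF partial_homeo_pinv[OF h_homeo] K this assms]
  obtain \<delta> where \<delta>: "\<delta> > 0"
    "\<forall>u\<in>?K. \<forall>v\<in>?K. d u v < \<delta> \<longrightarrow> d (the (pinv (h n) u)) (the (pinv (h n) v)) < \<epsilon>" by blast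
  have "coord n x \<in> ?K \<and> the (pinv (h n) (coord n x)) = x" if x: "x \<in> B n" for x
  proof -
    have hx: "h n x = Some (coord n x)" by (rule h_coord[OF x])
    then have "pinv (h n) (coord n x) = Some x" by (simp add: pinv_eq_Some_iff[OF h_homeo])
    then show ?thesis using hx x B_subset_C[of n] by (auto simp: pimage_def)
  qed
  then show "\<exists>\<delta>>0. \<forall>x\<in>B n. \<forall>y\<in>B n. d (coord n x) (coord n y) < \<delta> \<longrightarrow> d x y < \<epsilon>"
    using \<delta> by (intro exI[of _ \<delta>]) fastforce
qed (auto simp: chart_def)

lemma charted_maps_uniformly_equicontinuous:
  assumes K: "\<And>n x. x \<in> B n \<Longrightarrow> coord n x \<in> K"
    and words: "\<And>c. c > 0 \<Longrightarrow> \<exists>\<rho>>0. \<forall>w\<in>Wd. \<forall>u\<in>K. \<forall>v\<in>K. \<forall>u' v'.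
      w u = Some u' \<longrightarrow> w v = Some v' \<longrightarrow> d u v < \<rho> \<longrightarrow> d u' v' < c"
    and "\<epsilon> > 0"
  shows "\<exists>\<delta>>0. \<forall>f\<in>charted_maps. \<forall>x y x' y'. f x = Some x' \<longrightarrow> f y = Some y' \<longrightarrow> d x y < \<delta> \<longrightarrow> d x' y' < \<epsilon>"
proof -
  obtain \<theta> where \<theta>: "\<theta> > 0"
    "\<forall>n W x y. chart n W \<longrightarrow> x \<in> W \<longrightarrow> y \<in> W \<longrightarrow> d (coord n x) (coord n y) < \<theta> \<longrightarrow> d x y < \<epsilon>"
    using inverse_coord_uniformly_equicontinuous[OF \<open>\<epsilon> > 0\<close>] by blast
  obtain \<rho> where \<rho>: "\<rho> > 0" "\<forall>w\<in>Wd. \<forall>u\<in>K. \<forall>v\<in>K. \<forall>u' v'.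
      w u = Some u' \<longrightarrow> w v = Some v' \<longrightarrow> d u v < \<rho> \<longrightarrow> d u' v' < \<theta>"
    using words[OF \<theta>(1)] by blast
  obtain \<delta> where \<delta>: "\<delta> > 0"
    "\<forall>n W x y. chart n W \<longrightarrow> x \<in> W \<longrightarrow> y \<in> W \<longrightarrow> d x y < \<delta> \<longrightarrow> d (coord n x) (coord n y) < \<rho>"
    using coord_uniformly_equicontinuous[OF \<rho>(1)] by blast
  \<comment> \<open>The minimum with \<open>\<epsilon>\<close> serves the partial identities.\<close>
  have "d x' y' < \<epsilon>"
    if f: "f \<in> charted_maps" and xy: "f x = Some x'" "f y = Some y'" "d x y < min \<delta> \<epsilon>" for f x y x' y'
    using f
  proof (cases rule: charted_maps_cases)
    case identity
    have "x' = x" "y' = y" using identity(2) xy(1,2) by blast+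
    then show ?thesis using xy(3) by simp
  next
    case (linked n W k V w)
    then have l: "chart n W" "chart k V" "w \<in> Wd" "x \<in> W" "x' \<in> V" "w (coord n x) = Some (coord k x')"
      "y \<in> W" "y' \<in> V" "w (coord n y) = Some (coord k y')"
      using xy(1,2) unfolding linked_def by blast+
    have "d (coord n x) (coord n y) < \<rho>" using \<delta>(2) l(1,4,7) xy(3) by simp
    moreover have "coord n x \<in> K" "coord n y \<in> K"
      by (rule K[OF chart_subset[OF l(1) l(4)]], rule K[OF chart_subset[OF l(1) l(7)]])
    ultimately have "d (coord k x') (coord k y') < \<theta>" using \<rho>(2) l(3,6,9) by blast
    then show ?thesis using \<theta>(2) l(2,5,8) by blast
  qed
  then show ?thesis using \<delta>(1) \<open>\<epsilon> > 0\<close>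
    by (intro exI[of _ "min \<delta> \<epsilon>"] conjI ballI allI impI) auto
qed

text \<open>
  Infinitely many indices \<open>n\<close> may have charts around \<open>x\<close>, and the radius of the neighbourhood that
  witnesses the stability of \<open>coord n x\<close> is not bounded below in \<open>n\<close>. Fixing one \<open>m\<close> with \<open>x \<in> B m\<close>
  helps: any chart of index \<open>n > m\<close> around \<open>x\<close> is related by a word to \<open>h m\<close>, so only
  the coordinates of \<open>x\<close> with index at most \<open>m\<close> matter.
\<close>

lemma charted_maps_equicontinuous_at:
  assumes x: "x \<in> M" and st: "\<And>n c. x \<in> B n \<Longrightarrow> c > 0 \<Longrightarrow> stable c (coord n x)" and "\<epsilon> > 0"
  shows "\<exists>\<delta>>0. \<forall>f\<in>charted_maps. \<forall>y x' y'. f x = Some x' \<longrightarrow> f y = Some y' \<longrightarrow> d x y < \<delta> \<longrightarrow> d x' y' < \<epsilon>"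
proof -
  obtain \<theta> where \<theta>: "\<theta> > 0"
    "\<forall>n W x y. chart n W \<longrightarrow> x \<in> W \<longrightarrow> y \<in> W \<longrightarrow> d (coord n x) (coord n y) < \<theta> \<longrightarrow> d x y < \<epsilon>"
    using inverse_coord_uniformly_equicontinuous[OF \<open>\<epsilon> > 0\<close>] by blast
  obtain m where m: "x \<in> B m" using B_cover[OF x] by blast
  define Q where "Q k N \<longleftrightarrow> (\<forall>w\<in>Wd. \<forall>y\<in>N. \<forall>z\<in>N. \<forall>y' z'.
      w (coord k y) = Some y' \<longrightarrow> w (coord k z) = Some z' \<longrightarrow> d y' z' < \<theta>)" for k N
  have "\<exists>N. openin mtopology N \<and> x \<in> N \<and> (x \<in> B k \<longrightarrow> Q k N)" for k
  proof (cases "x \<in> B k")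
    case False
    then show ?thesis using x by (intro exI[of _ M]) simp
  next
    case True
    obtain N where N: "openin mtopology N" "coord k x \<in> N"
      "\<forall>w\<in>Wd. \<forall>y\<in>N. \<forall>z\<in>N. \<forall>y' z'. w y = Some y' \<longrightarrow> w z = Some z' \<longrightarrow> d y' z' < \<theta>"
      using st[OF True \<theta>(1)] unfolding stable_def by blast
    have "openin mtopology (h k -` Some ` N)" by (rule partial_homeo_openin_vimage[OF h_homeo N(1)])
    moreover have "x \<in> h k -` Some ` N" using h_coord[OF True] N(2) by simp
    moreover have "Q k (h k -` Some ` N)"
    proof -
      have "coord k y \<in> N" if "y \<in> h k -` Some ` N" for y using that by (auto simp: coord_def)
      then show ?thesis using N(3) unfolding Q_def by blast
    qed
    ultimately show ?thesis by blast
  qed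
  then obtain R where R: "\<And>k. openin mtopology (R k)" "\<And>k. x \<in> R k" "\<And>k. x \<in> B k \<longrightarrow> Q k (R k)"
    by metis
  have "openin mtopology (\<Inter>k\<le>m. R k)" by (rule openin_INT2) (auto intro: R(1))
  moreover have "x \<in> (\<Inter>k\<le>m. R k)" using R(2) by blast
  ultimately obtain r where r: "r > 0" "mball x r \<subseteq> (\<Inter>k\<le>m. R k)" unfolding openin_mtopology by blast
  \<comment> \<open>The minimum with \<open>\<epsilon>\<close> serves the partial identities.\<close>
  have "d x' y' < \<epsilon>"
    if f: "f \<in> charted_maps" and xy: "f x = Some x'" "f y = Some y'" "d x y < min r \<epsilon>" for f y x' y'
    using f
  proof (cases rule: charted_maps_cases)
    case identity
    have "x' = x" "y' = y" using identity(2) xy(1,2) by blast+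
    then show ?thesis using xy(3) by simp
  next
    case (linked n W k V w)
    then have l: "chart n W" "chart k V" "w \<in> Wd" "x \<in> W" "x' \<in> V" "w (coord n x) = Some (coord k x')"
      "y \<in> W" "y' \<in> V" "w (coord n y) = Some (coord k y')"
      using xy(1,2) unfolding linked_def by blast+
    \<comment> \<open>The coordinates \<open>h j\<close> replace \<open>h n\<close>: they agree up to a word on \<open>W\<close>, and \<open>j \<le> m\<close>.\<close>
    define j where "j = min n m"
    have xj: "x \<in> B j" using m chart_subset[OF l(1,4)] by (simp add: j_def min_def)
    then have ne: "W \<inter> B j \<noteq> {}" using l(4) by blast
    have "j \<le> n" "j \<le> m" by (simp_all add: j_def)
    from chart_transition_le[OF l(1) this(1) ne]
    obtain u where u: "u \<in> Wd" "\<forall>z\<in>W. u (coord n z) = Some (coord j z)" by blast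
    have hu: "u \<in> partial_homeos mtopology" by (rule G_homeo[OF word_in_G[OF u(1)]])
    have wu: "w \<circ>\<^sub>m pinv u \<in> Wd" by (rule word_comp[OF word_inv[OF u(1)] l(3)])
    have "(w \<circ>\<^sub>m pinv u) (coord j x) = Some (coord k x')" "(w \<circ>\<^sub>m pinv u) (coord j y) = Some (coord k y')"
      using u(2) l(4,6,7,9) by (auto simp: map_comp_Some_iff pinv_eq_Some_iff[OF hu])
    moreover have "x \<in> R j" by (rule R(2))
    moreover have "y \<in> R j"
    proof -
      have "y \<in> M" using partial_homeo_topspace(1)[OF G_homeo[OF linked(1)] xy(2)] by simp
      then have "y \<in> mball x r" using x xy(3) by simp
      then show ?thesis using r(2) \<open>j \<le> m\<close> by blast
    qed
    ultimately have "d (coord k x') (coord k y') < \<theta>"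
      using R(3)[of j] xj wu unfolding Q_def by blast
    then show ?thesis using \<theta>(2) l(2,5,8) by blast
  qed
  then show ?thesis using r(1) \<open>\<epsilon> > 0\<close>
    by (intro exI[of _ "min r \<epsilon>"] conjI ballI allI impI) auto
qed

end

section \<open>Existence of charts\<close>

context Metric_space begin

lemma exists_compact_chart:
  assumes G: "pseudo_star_group mtopology G"
    and N: "openin mtopology N" "compactin mtopology L" "N \<subseteq> L"
    and g: "g \<in> G" "g x = Some u" "u \<in> N"
  shows "\<exists>h B C. h \<in> G \<and> (\<forall>y z. h y = Some z \<longrightarrow> z \<in> N) \<and> openin mtopology B \<and> x \<in> B \<and>
     B \<subseteq> C \<and> compactin mtopology C \<and> C \<subseteq> dom h"
proof -
  have hg: "g \<in> partial_homeos mtopology" by (rule pseudo_star_groupD(1)[OF G g(1)])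
  have hp: "pinv g \<in> partial_homeos mtopology" by (rule partial_homeo_pinv[OF hg])
  have op: "openin mtopology (N \<inter> dom (pinv g))"
    by (rule openin_Int[OF N(1) partial_homeo_openin_dom[OF hp]])
  have uu: "u \<in> N \<inter> dom (pinv g)" using g(2,3) by (auto simp: pinv_eq_Some_iff[OF hg])
  have "neighbourhood_base_of (closedin mtopology) mtopology"
    by (simp add: neighbourhood_base_of_closedin regular_space_mtopology)
  then obtain B C where BC: "openin mtopology B" "closedin mtopology C" "u \<in> B" "B \<subseteq> C"
      "C \<subseteq> N \<inter> dom (pinv g)"
    using op uu unfolding neighbourhood_base_of by metis
  have "compactin mtopology C" by (rule closed_compactin[OF N(2) _ BC(2)]) (use BC(5) N(3) in blast)
  then have c: "compactin mtopology (pimage (pinv g) C)"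
    by (rule pimage_compactin[OF hp]) (use BC(5) in blast)
  have im: "y \<in> pimage (pinv g) A \<longleftrightarrow> (\<exists>a\<in>A. g y = Some a)" for y A
    by (simp add: pimage_def pinv_eq_Some_iff[OF hg])
  let ?h = "g |` (g -` Some ` N)"
  have "?h \<in> G" by (rule pseudo_star_group_restrict[OF G g(1) partial_homeo_openin_vimage[OF hg N(1)]])
  moreover have "\<forall>y z. ?h y = Some z \<longrightarrow> z \<in> N" by (auto simp: restrict_map_def)
  moreover have "openin mtopology (pimage (pinv g) B)" by (rule partial_homeo_openin_pimage[OF hp BC(1)])
  moreover have "x \<in> pimage (pinv g) B" using g(2) BC(3) by (auto simp: im)
  moreover have "pimage (pinv g) B \<subseteq> pimage (pinv g) C" using BC(4) unfolding pimage_def by blast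
  moreover have "pimage (pinv g) C \<subseteq> dom ?h"
  proof
    fix y assume "y \<in> pimage (pinv g) C"
    then obtain a where "a \<in> C" "g y = Some a" by (auto simp: im)
    then show "y \<in> dom ?h" using BC(5) by (auto simp: restrict_map_def)
  qed
  ultimately show ?thesis using c
    by (intro exI[of _ ?h] exI[of _ "pimage (pinv g) B"] exI[of _ "pimage (pinv g) C"] conjI)
qed

lemma exists_chart_family:
  assumes G: "pseudo_star_group mtopology G" and "separable_space mtopology" and "M \<noteq> {}"
    and N: "openin mtopology N" "compactin mtopology L" "N \<subseteq> L"
    and orb: "\<forall>x\<in>M. \<exists>g\<in>G. \<exists>u\<in>N. g x = Some u"
  obtains h :: "nat \<Rightarrow> 'a \<rightharpoonup> 'a" and B C where "\<forall>n. h n \<in> G \<and> (\<forall>y z. h n y = Some z \<longrightarrow> z \<in> N)"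
    "\<forall>n. openin mtopology (B n) \<and> B n \<subseteq> C n \<and> compactin mtopology (C n) \<and> C n \<subseteq> dom (h n)"
    "\<forall>x\<in>M. \<exists>n. x \<in> B n"
proof -
  have "\<exists>h B C. h \<in> G \<and> (\<forall>y z. h y = Some z \<longrightarrow> z \<in> N) \<and> openin mtopology B \<and> x \<in> B \<and>
     B \<subseteq> C \<and> compactin mtopology C \<and> C \<subseteq> dom h" if x: "x \<in> M" for x
  proof -
    obtain g u where "g \<in> G" "u \<in> N" "g x = Some u" using orb x by blast
    then show ?thesis by (intro exists_compact_chart[OF G N])
  qed
  then obtain h B C where hBC: "\<And>x. x \<in> M \<Longrightarrow> h x \<in> G \<and> (\<forall>y z. h x y = Some z \<longrightarrow> z \<in> N) \<and>
      openin mtopology (B x) \<and> x \<in> B x \<and> B x \<subseteq> C x \<and> compactin mtopology (C x) \<and> C x \<subseteq> dom (h x)"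
    by metis
  have "(\<forall>V\<in>B ` M. openin mtopology V) \<and> topspace mtopology \<subseteq> \<Union>(B ` M)" using hBC by auto
  then obtain \<V> where \<V>: "countable \<V>" "\<V> \<subseteq> B ` M" "topspace mtopology \<subseteq> \<Union>\<V>"
    using Lindelof_space_mtopology[OF assms(2)] unfolding Lindelof_space_alt by meson
  obtain A where A: "countable A" "A \<subseteq> M" "\<V> = B ` A"
    using \<V>(1,2) by (metis countable_subset_image)
  have "A \<noteq> {}" using \<V>(3) A(3) \<open>M \<noteq> {}\<close> by auto
  then obtain a :: "nat \<Rightarrow> 'a" where a: "range a = A" using A(1) by (metis uncountable_def)
  have aM: "a n \<in> M" for n using a A(2) by blast
  show thesis
  proof (rule that[of "\<lambda>n. h (a n)" "\<lambda>n. B (a n)" "\<lambda>n. C (a n)"])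
    show "\<forall>x\<in>M. \<exists>n. x \<in> B (a n)"
    proof
      fix x assume "x \<in> M"
      then have "x \<in> \<Union>(B ` range a)" using \<V>(3) unfolding a A(3)[symmetric] by auto
      then show "\<exists>n. x \<in> B (a n)" by blast
    qed
  qed (use hBC[OF aM] in blast)+
qed

text \<open>
  Charts with values in \<open>U\<close> alone would not do in the minimal case: the stability radius of a point of \<open>U\<close>
  may tend to zero towards the boundary of \<open>U\<close>. Since the closure of \<open>U\<close> is compact, finitely many
  compact pieces of maps into \<open>U\<close> move all of it, and hence every orbit, into a compact subset of \<open>U\<close>.
\<close>

lemma exists_compact_core:
  assumes G: "pseudo_star_group mtopology G"
    and U: "openin mtopology U" "compactin mtopology (mtopology closure_of U)"
    and orb: "\<forall>x\<in>M. \<exists>g\<in>G. \<exists>u\<in>U. g x = Some u"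
  obtains N K where "openin mtopology N" "compactin mtopology K" "N \<subseteq> K" "K \<subseteq> U"
    "\<forall>x\<in>M. \<exists>g\<in>G. \<exists>u\<in>N. g x = Some u"
proof -
  let ?L = "mtopology closure_of U"
  have LM: "?L \<subseteq> M" using closure_of_subset_topspace[of mtopology U] by simp
  have UL: "U \<subseteq> ?L" by (rule closure_of_subset[OF openin_subset[OF U(1)]])
  have "\<exists>h B C. h \<in> G \<and> (\<forall>y z. h y = Some z \<longrightarrow> z \<in> U) \<and> openin mtopology B \<and> x \<in> B \<and>
     B \<subseteq> C \<and> compactin mtopology C \<and> C \<subseteq> dom h" if x: "x \<in> ?L" for x
  proof -
    obtain g u where "g \<in> G" "u \<in> U" "g x = Some u" using orb x LM by blast
    then show ?thesis by (intro exists_compact_chart[OF G U UL])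
  qed
  then obtain h B C where hBC: "\<And>x. x \<in> ?L \<Longrightarrow> h x \<in> G \<and> (\<forall>y z. h x y = Some z \<longrightarrow> z \<in> U) \<and>
      openin mtopology (B x) \<and> x \<in> B x \<and> B x \<subseteq> C x \<and> compactin mtopology (C x) \<and> C x \<subseteq> dom (h x)"
    by metis
  have cov: "?L \<subseteq> \<Union>(B ` ?L)" using hBC by blast
  have "\<exists>\<F>. finite \<F> \<and> \<F> \<subseteq> B ` ?L \<and> ?L \<subseteq> \<Union>\<F>"
    by (rule compactinD[OF U(2) _ cov]) (use hBC in blast)
  then obtain \<F> where \<F>: "finite \<F>" "\<F> \<subseteq> B ` ?L" "?L \<subseteq> \<Union>\<F>" by blast
  obtain A where A: "A \<subseteq> ?L" "finite A" "\<F> = B ` A" using finite_subset_image[OF \<F>(1,2)] by blast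
  have a: "h x \<in> G" "h x y = Some z \<Longrightarrow> z \<in> U" "openin mtopology (B x)" "B x \<subseteq> C x"
    "compactin mtopology (C x)" "C x \<subseteq> dom (h x)" if "x \<in> A" for x y z
    using hBC[of x] that A(1) by blast+
  have ph: "h x \<in> partial_homeos mtopology" if "x \<in> A" for x
    by (rule pseudo_star_groupD(1)[OF G a(1)[OF that]])
  show thesis
  proof (rule that)
    show "openin mtopology (\<Union>x\<in>A. pimage (h x) (B x))"
      using partial_homeo_openin_pimage[OF ph a(3)] by blast
    show "compactin mtopology (\<Union>x\<in>A. pimage (h x) (C x))"
      using A(2) pimage_compactin[OF ph a(5,6)] by (intro compactin_Union) auto
    show "(\<Union>x\<in>A. pimage (h x) (B x)) \<subseteq> (\<Union>x\<in>A. pimage (h x) (C x))"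
      using a(4) unfolding pimage_def by blast
    show "(\<Union>x\<in>A. pimage (h x) (C x)) \<subseteq> U"
      using a(2) unfolding pimage_def by blast
    show "\<forall>x\<in>M. \<exists>g\<in>G. \<exists>u\<in>\<Union>x\<in>A. pimage (h x) (B x). g x = Some u"
    proof
      fix x assume "x \<in> M"
      then obtain g u where g: "g \<in> G" "u \<in> U" "g x = Some u" using orb by blast
      then have "u \<in> \<Union>(B ` A)" using UL \<F>(3) A(3) by blast
      then obtain b where b: "b \<in> A" "u \<in> B b" by blast
      then obtain v where v: "h b u = Some v" using a(4,6)[OF b(1)] by blast
      have "h b \<circ>\<^sub>m g \<in> G" by (rule pseudo_star_groupD(3)[OF G g(1) a(1)[OF b(1)]])
      moreover have "(h b \<circ>\<^sub>m g) x = Some v" using g(3) v by simp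
      moreover have "v \<in> (\<Union>x\<in>A. pimage (h x) (B x))" using b v by (auto simp: pimage_def)
      ultimately show "\<exists>g\<in>G. \<exists>u\<in>\<Union>x\<in>A. pimage (h x) (B x). g x = Some u" by blast
    qed
  qed
qed

end

section \<open>The dichotomy\<close>

context charts begin

lemma equicontinuous_point_charted_maps:
  assumes x: "x \<in> M" and st: "\<And>n c. x \<in> B n \<Longrightarrow> c > 0 \<Longrightarrow> stable c (coord n x)"
  shows "equicontinuous_point mtopology charted_maps (\<lambda>x y. ennreal (d x y)) x"
  unfolding equicontinuous_point_def star_closure_eq[OF pseudo_star_group_charted_maps] topspace_mtopology
proof (intro conjI allI impI)
  show "x \<in> M" by (rule x)
  fix \<epsilon> :: real assume \<epsilon>: "\<epsilon> > 0"
  obtain \<delta> where \<delta>: "\<delta> > 0"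
    "\<forall>f\<in>charted_maps. \<forall>y x' y'. f x = Some x' \<longrightarrow> f y = Some y' \<longrightarrow> d x y < \<delta> \<longrightarrow> d x' y' < \<epsilon>"
    using charted_maps_equicontinuous_at[OF x st \<epsilon>] by blast
  have "ennreal (d (the (s x)) (the (s y))) < ennreal \<epsilon>"
    if s: "s \<in> charted_maps" and xy: "x \<in> dom s \<and> y \<in> dom s \<and> ennreal (d x y) < ennreal \<delta>" for s y
  proof -
    obtain x' y' where "s x = Some x'" "s y = Some y'" using xy by blast
    moreover have "d x y < \<delta>" using xy by (simp add: ennreal_less_iff)
    ultimately show ?thesis using \<delta>(2) s by (simp add: ennreal_less_iff)
  qed
  then show "\<exists>\<delta>>0. \<forall>s\<in>charted_maps. \<forall>y. x \<in> dom s \<and> y \<in> dom s \<and> ennreal (d x y) < ennreal \<delta> \<longrightarrow>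
      ennreal (d (the (s x)) (the (s y))) < ennreal \<epsilon>"
    using \<delta>(1) by (intro exI[of _ \<delta>] conjI ballI allI impI)
qed

lemma stable_coord:
  assumes g: "g \<in> G" "g x = Some u" "stable c u" and x: "x \<in> B n"
  shows "stable c (coord n x)"
proof -
  have hx: "h n x = Some (coord n x)" by (rule h_coord[OF x])
  have "h n \<circ>\<^sub>m pinv g \<in> G" by (rule G_comp[OF G_inv[OF g(1)] h_in_G])
  moreover have "(h n \<circ>\<^sub>m pinv g) u = Some (coord n x)"
    using g(2) hx by (simp add: map_comp_Some_iff pinv_eq_Some_iff[OF G_homeo[OF g(1)]])
  ultimately show ?thesis using stable_invariant[OF g(3)] h_in_U[OF hx] by blast
qed

lemma stable_mono: "stable c u \<Longrightarrow> c \<le> c' \<Longrightarrow> stable c' u"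
  unfolding stable_def by (meson less_le_trans)

text \<open>
  Transitivity makes each set \<open>R c\<close> of points whose orbit contains a \<open>c\<close>-stable point dense, and the
  points in all \<open>R (1 / Suc n)\<close> are dense by Baire's theorem.
\<close>

lemma almost_equicontinuous_of_stable:
  assumes cm: "completely_metrizable_space mtopology"
    and trans: "topologically_transitive mtopology G"
    and ex: "\<forall>c>0. \<exists>u. stable c u"
  shows "almost_equicontinuous mtopology G"
proof -
  define R where "R c = (\<Union>g\<in>G. g -` Some ` {u. stable c u})" for c
  have oR: "openin mtopology (R c)" for c
    unfolding R_def using partial_homeo_openin_vimage[OF G_homeo openin_stable] by blast
  have dR: "mtopology closure_of R c = M" if "c > 0" for c
  proof -
    have "R c \<inter> V \<noteq> {}" if V: "openin mtopology V" "V \<noteq> {}" for V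
    proof -
      have "{u. stable c u} \<noteq> {}" using ex \<open>c > 0\<close> by blast
      then obtain g where g: "g \<in> G" "pimage g V \<inter> {u. stable c u} \<noteq> {}"
        using trans V openin_stable[of c] unfolding topologically_transitive_def by meson
      then show ?thesis unfolding R_def pimage_def by blast
    qed
    then show ?thesis using dense_intersects_open[of mtopology "R c"] by simp
  qed
  let ?I = "\<Inter>(range (\<lambda>n. R (1 / Suc n)))"
  have I: "mtopology closure_of ?I = topspace mtopology"
  proof (rule Baire_category)
    show "completely_metrizable_space mtopology \<or> locally_compact_space mtopology \<and> regular_space mtopology"
      using cm by blast
    show "countable (range (\<lambda>n. R (1 / Suc n)))" by simp
    show "openin mtopology V \<and> mtopology closure_of V = topspace mtopology"
      if "V \<in> range (\<lambda>n. R (1 / Suc n))" for V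
      using that oR dR by auto
  qed
  have sub: "?I \<subseteq> {x. equicontinuous_point mtopology charted_maps (\<lambda>x y. ennreal (d x y)) x}"
  proof
    fix x assume xI: "x \<in> ?I"
    then have "x \<in> R (1 / Suc 0)" by blast
    then have xM: "x \<in> M" using openin_subset[OF oR] by auto
    have "stable c (coord n x)" if n: "x \<in> B n" and c: "c > 0" for n c
    proof -
      obtain k where k: "1 / real (Suc k) < c" using nat_approx_posE[OF c] by metis
      have "x \<in> R (1 / Suc k)" using xI by blast
      then obtain g u where g: "g \<in> G" "g x = Some u" "stable (1 / Suc k) u"
        unfolding R_def by auto
      from stable_coord[OF g n] show ?thesis by (rule stable_mono) (use k in simp)
    qed
    then show "x \<in> {x. equicontinuous_point mtopology charted_maps (\<lambda>x y. ennreal (d x y)) x}"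
      using equicontinuous_point_charted_maps[OF xM] by blast
  qed
  have "mtopology closure_of {x. equicontinuous_point mtopology charted_maps (\<lambda>x y. ennreal (d x y)) x} = topspace mtopology"
    using closure_of_mono[OF sub, of mtopology] I closure_of_subset_topspace by (metis subset_antisym)
  then show ?thesis
    unfolding almost_equicontinuous_def using generates_charted_maps compatible_metric_ennreal by blast
qed

text \<open>
  By minimality every orbit enters the open set of \<open>c\<close>-stable points, so all of \<open>U\<close> is \<open>c\<close>-stable. The
  Lebesgue number of the compact set \<open>K\<close> then gives a uniform radius where the coordinates live.
\<close>

lemma equicontinuous_of_stable:
  assumes min: "minimal_action mtopology G"
    and K: "compactin mtopology K" "K \<subseteq> U" "\<forall>n. \<forall>x\<in>B n. coord n x \<in> K"
    and ex: "\<forall>c>0. \<exists>u. stable c u"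
  shows "equicontinuous mtopology G"
proof -
  have all: "stable c u" if c: "c > 0" and u: "u \<in> U" for c u
  proof -
    have uM: "u \<in> M" using u openin_subset[OF openin_U] by auto
    obtain v where v: "stable c v" using ex c by blast
    have "v \<in> mtopology closure_of orbit_of G u"
      using min uM v openin_subset[OF openin_stable, of c] unfolding minimal_action_def by auto
    then obtain v' where "v' \<in> orbit_of G u" "stable c v'"
      using v openin_stable[of c] unfolding in_closure_of by blast
    then obtain g where g: "g \<in> G" "g u = Some v'" by (auto simp: orbit_of_def)
    have "pinv g v' = Some u" using g(2) by (simp add: pinv_eq_Some_iff[OF G_homeo[OF g(1)]])
    from stable_invariant[OF \<open>stable c v'\<close> G_inv[OF g(1)] this u] show ?thesis .
  qed
  have words: "\<exists>\<rho>>0. \<forall>w\<in>Wd. \<forall>u\<in>K. \<forall>v\<in>K. \<forall>u' v'.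
      w u = Some u' \<longrightarrow> w v = Some v' \<longrightarrow> d u v < \<rho> \<longrightarrow> d u' v' < c" if c: "c > 0" for c
  proof -
    let ?Q = "\<lambda>N. \<forall>w\<in>Wd. \<forall>y\<in>N. \<forall>z\<in>N. \<forall>y' z'. w y = Some y' \<longrightarrow> w z = Some z' \<longrightarrow> d y' z' < c"
    obtain \<rho> where \<rho>: "\<rho> > 0" "\<And>x. x \<in> K \<Longrightarrow> \<exists>V. ?Q V \<and> mball x \<rho> \<subseteq> V"
    proof (rule Lebesgue_number_compactin[OF K(1)])
      fix x assume "x \<in> K"
      then have "stable c x" using all[OF c] K(2) by blast
      then show "\<exists>V. openin mtopology V \<and> x \<in> V \<and> ?Q V" unfolding stable_def by (rule conjunct2)
    qed blast
    have "d u' v' < c"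
      if w: "w \<in> Wd" "u \<in> K" "v \<in> K" "w u = Some u'" "w v = Some v'" "d u v < \<rho>" for w u v u' v'
    proof -
      obtain V where V: "?Q V" "mball u \<rho> \<subseteq> V" using \<rho>(2)[OF w(2)] by (elim exE conjE)
      have "K \<subseteq> M" using compactin_subset_topspace[OF K(1)] by simp
      then have "u \<in> mball u \<rho>" "v \<in> mball u \<rho>" using w(2,3,6) \<rho>(1) by auto
      then have "u \<in> V" "v \<in> V" using V(2) by blast+
      then show ?thesis using V(1) w(1,4,5) by blast
    qed
    then show ?thesis using \<rho>(1) by (intro exI[of _ \<rho>] conjI ballI allI impI)
  qed
  have coordK: "coord n x \<in> K" if "x \<in> B n" for n x using K(3) that by blast
  have "\<exists>\<delta>. \<epsilon> > 0 \<longrightarrow> \<delta> > 0 \<and> (\<forall>f\<in>charted_maps. \<forall>x y x' y'. f x = Some x' \<longrightarrow> f y = Some y' \<longrightarrow> d x y < \<delta> \<longrightarrow> d x' y' < \<epsilon>)"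
    for \<epsilon> :: real
    using charted_maps_uniformly_equicontinuous[OF coordK words, of \<epsilon>] by blast
  then obtain \<delta> :: "real \<Rightarrow> real" where \<delta>: "\<And>\<epsilon>. \<epsilon> > 0 \<Longrightarrow> \<delta> \<epsilon> > 0 \<and>
      (\<forall>f\<in>charted_maps. \<forall>x y x' y'. f x = Some x' \<longrightarrow> f y = Some y' \<longrightarrow> d x y < \<delta> \<epsilon> \<longrightarrow> d x' y' < \<epsilon>)"
    by metis
  have "ennreal (d (the (s x)) (the (s y))) < ennreal \<epsilon>"
    if s: "\<epsilon> > 0" "s \<in> charted_maps" "x \<in> dom s" "y \<in> dom s" "ennreal (d x y) < ennreal (\<delta> \<epsilon>)" for \<epsilon> s x y
  proof -
    obtain x' y' where "s x = Some x'" "s y = Some y'" using s(3,4) by blast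
    moreover have "d x y < \<delta> \<epsilon>" using s(5) by (simp add: ennreal_less_iff)
    ultimately show ?thesis using \<delta>[OF s(1)] s(2) by (simp add: ennreal_less_iff)
  qed
  then show ?thesis
    unfolding equicontinuous_def
    using pseudo_star_group_charted_maps generates_charted_maps compatible_metric_ennreal \<delta>
    by (intro exI[of _ charted_maps] exI[of _ "\<lambda>x y. ennreal (d x y)"] exI[of _ \<delta>] conjI allI impI ballI) simp_all
qed

end

lemma (in Metric_space) not_sensitive_imp:
  assumes cm: "completely_metrizable_space mtopology" and sep: "separable_space mtopology" and ne: "M \<noteq> {}"
    and pg: "pseudogroup mtopology G" and cgs: "compact_generation_system mtopology G U F F'"
    and trans: "topologically_transitive mtopology G"
    and S: "pseudo_star_group mtopology S" and gen: "generates mtopology S G"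
    and nonsens: "\<forall>c>0. \<exists>x\<in>M. \<exists>r>0. \<forall>s\<in>S. \<forall>y x' y'. s x = Some x' \<longrightarrow> s y = Some y' \<longrightarrow>
       d x y < r \<longrightarrow> d x' y' < c"
  shows "almost_equicontinuous mtopology G \<and> (minimal_action mtopology G \<longrightarrow> equicontinuous mtopology G)"
proof -
  have U: "openin mtopology U" "compactin mtopology (mtopology closure_of U)"
    and orb: "\<forall>x\<in>M. orbit_of G x \<inter> U \<noteq> {}"
    and F: "F \<subseteq> pg_restrict G U" "finite F" "symmetric_maps F"
    and F'G: "F' \<subseteq> G" and genU: "generates (subtopology mtopology U) F (pg_restrict G U)"
    using cgs by (simp_all add: compact_generation_system_def)
  obtain e where bij: "bij_betw e F F'" and e': "\<forall>f\<in>F. f \<subseteq>\<^sub>m e f \<and> mtopology closure_of (dom f) \<subseteq> dom (e f)"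
    using cgs unfolding compact_generation_system_def by blast
  have e: "\<forall>f\<in>F. e f \<in> G \<and> f \<subseteq>\<^sub>m e f \<and> mtopology closure_of dom f \<subseteq> dom (e f)"
  proof
    fix f assume f: "f \<in> F"
    have "e f \<in> G" by (rule subsetD[OF F'G bij_betw_apply[OF bij f]])
    then show "e f \<in> G \<and> f \<subseteq>\<^sub>m e f \<and> mtopology closure_of dom f \<subseteq> dom (e f)"
      using bspec[OF e' f] by (rule conjI)
  qed
  have domF: "\<forall>f\<in>F. dom f \<subseteq> U" using F(1) by (auto simp: pg_restrict_def)
  have star: "pseudo_star_group mtopology G" using pg by (simp add: pseudogroup_def)
  interpret metric_word_system M d G U "words U F"
    by (intro metric_word_system.intro Metric_space_axioms word_system_words pg U F genU)
  obtain \<delta> where \<delta>: "\<delta> > 0" "\<forall>f\<in>F. \<forall>p\<in>dom f.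
      \<exists>t\<in>S. \<forall>z\<in>mball p \<delta>. z \<in> dom t \<and> (\<forall>w. f z = Some w \<longrightarrow> t z = Some w)"
    by (rule extension_radius[OF S gen U(2) F(2) domF e])
  have ex: "\<forall>c>0. \<exists>u. stable c u"
    using exists_stable[OF refl S gen \<delta> orb nonsens] by (intro allI impI)
  have orb': "\<forall>x\<in>M. \<exists>g\<in>G. \<exists>u\<in>U. g x = Some u"
    using orb unfolding orbit_of_def by blast
  obtain N K where N: "openin mtopology N" and K: "compactin mtopology K" and NK: "N \<subseteq> K" and KU: "K \<subseteq> U"
    and orbN: "\<forall>x\<in>M. \<exists>g\<in>G. \<exists>u\<in>N. g x = Some u"
    by (rule exists_compact_core[OF star U orb'])
  obtain h :: "nat \<Rightarrow> 'a \<rightharpoonup> 'a" and B C where h: "\<forall>n. h n \<in> G \<and> (\<forall>y z. h n y = Some z \<longrightarrow> z \<in> N)"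
    and BC: "\<forall>n. openin mtopology (B n) \<and> B n \<subseteq> C n \<and> compactin mtopology (C n) \<and> C n \<subseteq> dom (h n)"
    "\<forall>x\<in>M. \<exists>n. x \<in> B n"
    by (rule exists_chart_family[OF star sep ne N K NK orbN])
  interpret charts M d G U "words U F" h B C
    by unfold_locales (use h BC NK KU in blast)+
  have "\<forall>n. \<forall>x\<in>B n. coord n x \<in> K"
    using h h_coord NK by blast
  then show ?thesis
    using almost_equicontinuous_of_stable[OF cm trans ex] equicontinuous_of_stable[OF _ K KU _ ex] by blast
qed

lemma sensitive_imp_not_almost_equicontinuous:
  assumes "topspace X \<noteq> {}" and sens: "sensitive X G"
  shows "\<not> almost_equicontinuous X G"
proof
  assume "almost_equicontinuous X G"
  then obtain S d where gen: "generates X S G" and d: "compatible_metric X d"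
    and dense: "X closure_of {x. equicontinuous_point X S d x} = topspace X"
    unfolding almost_equicontinuous_def by blast
  have "{x. equicontinuous_point X S d x} \<noteq> {}"
  proof
    assume "{x. equicontinuous_point X S d x} = {}"
    then have "X closure_of {x. equicontinuous_point X S d x} = {}" by simp
    then show False using dense assms(1) by simp
  qed
  then obtain x where x: "equicontinuous_point X S d x" by blast
  have "pseudo_star_group X (star_closure X S)"
    using gen by (intro pseudo_star_group_star_closure[of S G]) (simp_all add: generates_def pseudogroup_def)
  then have "compatible_metric X d \<and> pseudo_star_group X (star_closure X S) \<and> star_closure X S \<subseteq> G \<and>
      generates X (star_closure X S) G"
    by (intro conjI d generates_star_closure[OF gen])
  from sens[unfolded sensitive_def, THEN spec, THEN spec, THEN mp, OF this]
  obtain c :: real where c: "c > 0" "\<forall>x\<in>topspace X. \<forall>r::real. r > 0 \<longrightarrow>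
      (\<exists>s\<in>star_closure X S. \<exists>y. x \<in> dom s \<and> y \<in> dom s \<and>
        d x y < ennreal r \<and> d (the (s x)) (the (s y)) \<ge> ennreal c)"
    by (elim exE conjE)
  have xX: "x \<in> topspace X" using x by (simp add: equicontinuous_point_def)
  obtain \<delta> :: real where \<delta>: "\<delta> > 0" "\<forall>s\<in>star_closure X S. \<forall>y. x \<in> dom s \<and> y \<in> dom s \<and> d x y < ennreal \<delta> \<longrightarrow>
        d (the (s x)) (the (s y)) < ennreal c"
    using x c(1) unfolding equicontinuous_point_def by blast
  from c(2)[rule_format, OF xX \<delta>(1)]
  obtain s y where s: "s \<in> star_closure X S" "x \<in> dom s \<and> y \<in> dom s \<and> d x y < ennreal \<delta>"
    and ge: "d (the (s x)) (the (s y)) \<ge> ennreal c"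
    by blast
  have "d (the (s x)) (the (s y)) < ennreal c" using \<delta>(2) s by blast
  then show False using ge by (simp add: not_le[symmetric])
qed

lemma equicontinuous_imp_almost_equicontinuous:
  assumes "equicontinuous X G" shows "almost_equicontinuous X G"
proof -
  obtain S d and \<delta> :: "real \<Rightarrow> real" where S: "pseudo_star_group X S" "generates X S G" "compatible_metric X d"
    and \<delta>: "\<forall>\<epsilon>>0. \<delta> \<epsilon> > 0 \<and> (\<forall>s\<in>S. \<forall>x\<in>dom s. \<forall>y\<in>dom s. d x y < ennreal (\<delta> \<epsilon>) \<longrightarrow>
          d (the (s x)) (the (s y)) < ennreal \<epsilon>)"
    using assms unfolding equicontinuous_def by blast
  have "equicontinuous_point X S d x" if x: "x \<in> topspace X" for x
    unfolding equicontinuous_point_def star_closure_eq[OF S(1)]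
  proof (intro conjI allI impI)
    fix \<epsilon> :: real assume "\<epsilon> > 0"
    then show "\<exists>\<delta>>0. \<forall>s\<in>S. \<forall>y. x \<in> dom s \<and> y \<in> dom s \<and> d x y < ennreal \<delta> \<longrightarrow>
        d (the (s x)) (the (s y)) < ennreal \<epsilon>"
      using \<delta> by (intro exI[of _ "\<delta> \<epsilon>"]) blast
  qed (rule x)
  then have "{x. equicontinuous_point X S d x} = topspace X" by (auto simp: equicontinuous_point_def)
  then show ?thesis unfolding almost_equicontinuous_def using S(2,3)
    by (intro exI[of _ S] exI[of _ d]) simp
qed

text \<open>
  Restricting to constants at most \<open>1\<close> is harmless in the failure of sensitivity, and below \<open>1\<close> the given
  metric and its truncation agree.
\<close>

lemma not_sensitive_dichotomy:
  assumes cm: "completely_metrizable_space X" and sep: "separable_space X"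
    and pg: "pseudogroup X G" and cg: "compactly_generated X G" and trans: "topologically_transitive X G"
    and ns: "\<not> sensitive X G"
  shows "almost_equicontinuous X G \<and> (minimal_action X G \<longrightarrow> equicontinuous X G)"
proof -
  obtain d S where dS: "compatible_metric X d \<and> pseudo_star_group X S \<and> S \<subseteq> G \<and> generates X S G"
    and no: "\<not> (\<exists>c::real. c > 0 \<and> (\<forall>x\<in>topspace X. \<forall>r::real. r > 0 \<longrightarrow>
          (\<exists>s\<in>S. \<exists>y. x \<in> dom s \<and> y \<in> dom s \<and> d x y < ennreal r \<and> d (the (s x)) (the (s y)) \<ge> ennreal c)))"
    using ns unfolding sensitive_def not_all not_imp by (elim exE conjE) (rule that; (intro conjI)?)
  have d: "compatible_metric X d" and S: "pseudo_star_group X S" "generates X S G" using dS by simp_all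
  define P where "P c x r \<longleftrightarrow> (\<exists>s\<in>S. \<exists>y. x \<in> dom s \<and> y \<in> dom s \<and> d x y < ennreal r \<and>
      d (the (s x)) (the (s y)) \<ge> ennreal c)" for c x r
  have nd: "\<exists>x\<in>topspace X. \<exists>r>0::real. \<forall>s\<in>S. \<forall>y. x \<in> dom s \<longrightarrow> y \<in> dom s \<longrightarrow> d x y < ennreal r \<longrightarrow>
        d (the (s x)) (the (s y)) < ennreal c" if c: "c > 0" for c :: real
  proof -
    obtain x r where xr: "x \<in> topspace X" "r > 0" "\<not> P c x r"
      using no[folded P_def] c by blast
    have "\<forall>s\<in>S. \<forall>y. x \<in> dom s \<longrightarrow> y \<in> dom s \<longrightarrow> d x y < ennreal r \<longrightarrow>
        d (the (s x)) (the (s y)) < ennreal c"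
    proof (intro ballI allI impI, rule ccontr)
      fix s y assume s: "s \<in> S" "x \<in> dom s" "y \<in> dom s" "d x y < ennreal r"
        and "\<not> d (the (s x)) (the (s y)) < ennreal c"
      then have "d (the (s x)) (the (s y)) \<ge> ennreal c" by (simp only: not_less)
      with s have "P c x r" unfolding P_def by blast
      with xr(3) show False ..
    qed
    then show ?thesis using xr(1,2) by blast
  qed
  have ne: "topspace X \<noteq> {}" using nd[of 1] by auto
  obtain m where m: "Metric_space (topspace X) m" and mX: "Metric_space.mtopology (topspace X) m = X"
    and less: "\<And>x y c. x \<in> topspace X \<Longrightarrow> y \<in> topspace X \<Longrightarrow> 0 < c \<Longrightarrow> c \<le> 1 \<Longrightarrow> d x y < ennreal c \<longleftrightarrow> m x y < c"
    using compatible_metric_truncate[OF d] by blast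
  interpret Metric_space "topspace X" m by (rule m)
  obtain U F F' where cgs: "compact_generation_system X G U F F'"
    using cg unfolding compactly_generated_def by blast
  have "\<forall>c>0. \<exists>x\<in>topspace X. \<exists>r>0. \<forall>s\<in>S. \<forall>y x' y'. s x = Some x' \<longrightarrow> s y = Some y' \<longrightarrow>
      m x y < r \<longrightarrow> m x' y' < c"
  proof (intro allI impI)
    fix c :: real assume c: "c > 0"
    have c1: "min c 1 > 0" "min c 1 \<le> 1" using c by simp_all
    from nd[OF c1(1)] obtain x and r :: real where x: "x \<in> topspace X" "r > 0"
      "\<forall>s\<in>S. \<forall>y. x \<in> dom s \<longrightarrow> y \<in> dom s \<longrightarrow> d x y < ennreal r \<longrightarrow>
        d (the (s x)) (the (s y)) < ennreal (min c 1)" by (elim bexE exE conjE)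
    have "m x' y' < c" if s: "s \<in> S" "s x = Some x'" "s y = Some y'" "m x y < min r 1" for s y x' y'
    proof -
      note hs = pseudo_star_groupD(1)[OF S(1) s(1)]
      note t = partial_homeo_topspace[OF hs s(2)] partial_homeo_topspace[OF hs s(3)]
      have "d x y < ennreal (min r 1)" using less[OF t(1,3), of "min r 1"] s(4) x(2) by simp
      also have "\<dots> \<le> ennreal r" by (rule ennreal_leI) simp
      finally have "d x y < ennreal r" .
      moreover have "x \<in> dom s" "y \<in> dom s" using s(2,3) by blast+
      ultimately have "d (the (s x)) (the (s y)) < ennreal (min c 1)" using x(3) s(1) by blast
      then have "d x' y' < ennreal (min c 1)" using s(2,3) by simp
      then have "m x' y' < min c 1" using less[OF t(2,4) c1] by blast
      then show ?thesis by simp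
    qed
    then show "\<exists>x\<in>topspace X. \<exists>r>0. \<forall>s\<in>S. \<forall>y x' y'. s x = Some x' \<longrightarrow> s y = Some y' \<longrightarrow>
        m x y < r \<longrightarrow> m x' y' < c"
      using x(1,2) by (intro bexI[of _ x] exI[of _ "min r 1"] conjI) auto
  qed
  then show ?thesis
    by (rule not_sensitive_imp[unfolded mX, OF cm sep ne pg cgs trans S])
qed

theorem theorem1p10:
  fixes X :: "'a topology" and G :: "('a \<rightharpoonup> 'a) set"
  assumes "completely_metrizable_space X" and "separable_space X"
    and "pseudogroup X G"
    and "compactly_generated X G"
    and "topologically_transitive X G"
  shows "(sensitive X G \<or> almost_equicontinuous X G) \<and>
         (topspace X \<noteq> {} \<longrightarrow> \<not> (sensitive X G \<and> almost_equicontinuous X G)) \<and>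
         (minimal_action X G \<longrightarrow>
           (sensitive X G \<or> equicontinuous X G) \<and>
           (topspace X \<noteq> {} \<longrightarrow> \<not> (sensitive X G \<and> equicontinuous X G)))"
  using not_sensitive_dichotomy[OF assms] sensitive_imp_not_almost_equicontinuous[of X G]
    equicontinuous_imp_almost_equicontinuous[of X G] by blast

end
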